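(* Let $(W,S)$ be any Coxeter system, let $s\in S$, and let $\Delta^{\rm odd}_s$ be the component of $\Delta^{\rm odd}$ containing $s$. Let $Z$ be a set of edge-loops in $\Delta^{\rm odd}_s$ based at $s$ that generates $\pi_1(\Delta^{\rm odd},s)$. For each vertex $t$ of $\Delta^{\rm odd}_s$, let an edge-path $\delta_t$ in $\Delta^{\rm odd}_s$ from $s$ to $t$ be given. Then the elements $p_\gamma$ with $\gamma\in Z$ generate $\Gamma_\Omega$, and together with the elements $r_{\delta_t,u}$ (where $t$ varies over the vertices of $\Delta^{\rm odd}_s$ and $u$ over the elements of $S$ evenly joined to $t$) they generate $W_\Omega\rtimes\Gamma_\Omega$. In particular, if $S$ is finite then the centralizer $C_W(s)$ is finitely generated.
   Context: A Coxeter system $(W,S)$ is a group $W$ with a generating set $S$ (possibly infinite) of involutions such that the relations $(ss')^{o(ss')}=1$ ($s,s'\in S$) present $W$, where $o(ss')$ is the order of $ss'$ (no relation if it is $\infty$). A reflection in $W$ is an element conjugate into $S$. Distinct $t,u\in S$ are "evenly joined" if $o(tu)$ is finite and even (including $2$). The odd Coxeter diagram $\Delta^{\rm odd}$ is the graph with vertex set $S$ and distinct $s,s'$ joined iff $o(ss')$ is finite and odd. For an edge-path $\gamma=(t_0,\dots,t_n)$ in $\Delta^{\rm odd}$, with $2l_i+1=o(t_{i-1}t_i)$, set $p_\gamma:=(t_1t_0)^{l_1}(t_2t_1)^{l_2}\cdots(t_nt_{n-1})^{l_n}$, with $p_\gamma=1$ if $n=0$. If $u\in S$ is evenly joined to $t_n$,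 with $o(ut_n)=2\lambda$, set $r_{\gamma,u}:=p_\gamma\cdot(ut_n)^{\lambda-1}u\cdot p_\gamma^{-1}$. $W_\Omega$ is the subgroup of $C_W(s)$ generated by all the reflections it contains except $s$. $\Gamma_\Omega$ is the subgroup of $W$ generated by the elements $p_\gamma$, where $\gamma$ varies over all edge-loops in $\Delta^{\rm odd}$ based at $s$. ($\Gamma_\Omega$ normalizes $W_\Omega$, the subgroup they generate in $W$ is their semidirect product $W_\Omega\rtimes\Gamma_\Omega$, and $C_W(s)=\langle s\rangle\times(W_\Omega\rtimes\Gamma_\Omega)$.) *)

theory Defs
  imports "HOL-Algebra.Multiplicative_Group" "HOL-Algebra.Generated_Groups"
begin

section \<open>Group presentations and Coxeter systems\<close>

text \<open>A letter \<open>(x, True)\<close> stands for the generator \<open>x\<close>, and \<open>(x, False)\<close> for its formal inverse.\<close>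

type_synonym 'a signed_word = "('a \<times> bool) list"

abbreviation signed_words :: "'a set \<Rightarrow> 'a signed_word set" where
  "signed_words S \<equiv> lists (S \<times> UNIV)"

fun word_value :: "('a, 'b) monoid_scheme \<Rightarrow> 'a signed_word \<Rightarrow> 'a" where
  "word_value G [] = \<one>\<^bsub>G\<^esub>"
| "word_value G ((x, b) # w) = (if b then x else inv\<^bsub>G\<^esub> x) \<otimes>\<^bsub>G\<^esub> word_value G w"

text \<open>Two words over \<open>S\<close> are related iff they represent the same element of the abstract group
  with generators \<open>S\<close> and relators \<open>R\<close>, i.e. of the free group on \<open>S\<close> modulo the normal
  closure of \<open>R\<close>.\<close>

inductive presentation_equiv ::
    "'a set \<Rightarrow> 'a signed_word set \<Rightarrow> 'a signed_word \<Rightarrow> 'a signed_word \<Rightarrow> bool"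
  for S R where
  refl: "w \<in> signed_words S \<Longrightarrow> presentation_equiv S R w w"
| sym: "presentation_equiv S R v w \<Longrightarrow> presentation_equiv S R w v"
| trans: "presentation_equiv S R u v \<Longrightarrow> presentation_equiv S R v w \<Longrightarrow> presentation_equiv S R u w"
| cancel: "u \<in> signed_words S \<Longrightarrow> v \<in> signed_words S \<Longrightarrow> x \<in> S
    \<Longrightarrow> presentation_equiv S R (u @ [(x, b), (x, \<not> b)] @ v) (u @ v)"
| relator: "u \<in> signed_words S \<Longrightarrow> v \<in> signed_words S \<Longrightarrow> r \<in> R
    \<Longrightarrow> presentation_equiv S R (u @ r @ v) (u @ v)"

definition presented_by :: "('a, 'b) monoid_scheme \<Rightarrow> 'a set \<Rightarrow> 'a signed_word set \<Rightarrow> bool" where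
  "presented_by G S R \<longleftrightarrow>
     S \<subseteq> carrier G \<and> R \<subseteq> signed_words S \<and> generate G S = carrier G \<and>
     (\<forall>w \<in> signed_words S. word_value G w = \<one>\<^bsub>G\<^esub> \<longleftrightarrow> presentation_equiv S R w [])"

text \<open>\<open>group.ord G x\<close> is \<open>0\<close> when \<open>x\<close> has infinite order; such pairs give no relator.\<close>

definition coxeter_relators :: "('a, 'b) monoid_scheme \<Rightarrow> 'a set \<Rightarrow> 'a signed_word set" where
  "coxeter_relators W S =
     {concat (replicate (group.ord W (s \<otimes>\<^bsub>W\<^esub> s')) [(s, True), (s', True)]) | s s'.
        s \<in> S \<and> s' \<in> S \<and> group.ord W (s \<otimes>\<^bsub>W\<^esub> s') \<noteq> 0}"

definition coxeter_system :: "('a, 'b) monoid_scheme \<Rightarrow> 'a set \<Rightarrow> bool" where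
  "coxeter_system W S \<longleftrightarrow>
     group W \<and> S \<subseteq> carrier W \<and> (\<forall>s \<in> S. group.ord W s = 2) \<and>
     presented_by W S (coxeter_relators W S)"


section \<open>The edge-path group of a graph\<close>

text \<open>A graph is given by a vertex set \<open>V\<close> and a symmetric adjacency relation \<open>E\<close>; an edge-path
  is the nonempty list of the vertices it visits.\<close>

definition edge_path :: "'a set \<Rightarrow> ('a \<Rightarrow> 'a \<Rightarrow> bool) \<Rightarrow> 'a \<Rightarrow> 'a \<Rightarrow> 'a list \<Rightarrow> bool" where
  "edge_path V E x y \<gamma> \<longleftrightarrow>
     \<gamma> \<noteq> [] \<and> set \<gamma> \<subseteq> V \<and> successively E \<gamma> \<and> hd \<gamma> = x \<and> last \<gamma> = y"

definition edge_loops :: "'a set \<Rightarrow> ('a \<Rightarrow> 'a \<Rightarrow> bool) \<Rightarrow> 'a \<Rightarrow> 'a list set" where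
  "edge_loops V E x = {\<gamma>. edge_path V E x x \<gamma>}"

definition component :: "'a set \<Rightarrow> ('a \<Rightarrow> 'a \<Rightarrow> bool) \<Rightarrow> 'a \<Rightarrow> 'a set" where
  "component V E x = {y. \<exists>\<gamma>. edge_path V E x y \<gamma>}"

text \<open>Homotopy of edge-loops in a graph is generated by removing and inserting backtracks.\<close>

inductive loop_homotopic ::
    "'a set \<Rightarrow> ('a \<Rightarrow> 'a \<Rightarrow> bool) \<Rightarrow> 'a \<Rightarrow> 'a list \<Rightarrow> 'a list \<Rightarrow> bool"
  for V E x where
  refl: "\<gamma> \<in> edge_loops V E x \<Longrightarrow> loop_homotopic V E x \<gamma> \<gamma>"
| sym: "loop_homotopic V E x \<gamma> \<gamma>' \<Longrightarrow> loop_homotopic V E x \<gamma>' \<gamma>"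
| trans: "loop_homotopic V E x \<gamma> \<gamma>' \<Longrightarrow> loop_homotopic V E x \<gamma>' \<gamma>''
    \<Longrightarrow> loop_homotopic V E x \<gamma> \<gamma>''"
| backtrack: "\<alpha> @ [t, u, t] @ \<beta> \<in> edge_loops V E x
    \<Longrightarrow> loop_homotopic V E x (\<alpha> @ [t, u, t] @ \<beta>) (\<alpha> @ [t] @ \<beta>)"

definition loop_class :: "'a set \<Rightarrow> ('a \<Rightarrow> 'a \<Rightarrow> bool) \<Rightarrow> 'a \<Rightarrow> 'a list \<Rightarrow> 'a list set" where
  "loop_class V E x \<gamma> = {\<gamma>'. loop_homotopic V E x \<gamma> \<gamma>'}"

text \<open>\<open>\<gamma> @ tl \<gamma>'\<close> is the concatenation of the loops \<open>\<gamma>\<close> and \<open>\<gamma>'\<close>.\<close>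

definition fundamental_group :: "'a set \<Rightarrow> ('a \<Rightarrow> 'a \<Rightarrow> bool) \<Rightarrow> 'a \<Rightarrow> 'a list set monoid" where
  "fundamental_group V E x =
     \<lparr>carrier = loop_class V E x ` edge_loops V E x,
      mult = (\<lambda>A B. \<Union>\<gamma>\<in>A. \<Union>\<gamma>'\<in>B. loop_class V E x (\<gamma> @ tl \<gamma>')),
      one = loop_class V E x [x]\<rparr>"


section \<open>The centralizer of a reflection\<close>

definition centralizer :: "('a, 'b) monoid_scheme \<Rightarrow> 'a \<Rightarrow> 'a set" where
  "centralizer G s = {g \<in> carrier G. g \<otimes>\<^bsub>G\<^esub> s = s \<otimes>\<^bsub>G\<^esub> g}"

definition finitely_generated :: "('a, 'b) monoid_scheme \<Rightarrow> bool" where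
  "finitely_generated G \<longleftrightarrow> (\<exists>A. finite A \<and> A \<subseteq> carrier G \<and> generate G A = carrier G)"

definition reflections :: "('a, 'b) monoid_scheme \<Rightarrow> 'a set \<Rightarrow> 'a set" where
  "reflections W S = {g \<otimes>\<^bsub>W\<^esub> t \<otimes>\<^bsub>W\<^esub> inv\<^bsub>W\<^esub> g | g t. g \<in> carrier W \<and> t \<in> S}"

definition evenly_joined :: "('a, 'b) monoid_scheme \<Rightarrow> 'a \<Rightarrow> 'a \<Rightarrow> bool" where
  "evenly_joined W t u \<longleftrightarrow>
     t \<noteq> u \<and> group.ord W (t \<otimes>\<^bsub>W\<^esub> u) \<noteq> 0 \<and> even (group.ord W (t \<otimes>\<^bsub>W\<^esub> u))"

definition oddly_joined :: "('a, 'b) monoid_scheme \<Rightarrow> 'a \<Rightarrow> 'a \<Rightarrow> bool" where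
  "oddly_joined W t u \<longleftrightarrow> t \<noteq> u \<and> odd (group.ord W (t \<otimes>\<^bsub>W\<^esub> u))"

text \<open>For consecutive vertices \<open>t\<close>, \<open>u\<close> the order of \<open>t u\<close> is \<open>2 l + 1\<close>, so that
  \<open>l\<close> is the integer quotient by 2.\<close>

fun path_element :: "('a, 'b) monoid_scheme \<Rightarrow> 'a list \<Rightarrow> 'a" where
  "path_element W (t # u # \<gamma>) =
     (u \<otimes>\<^bsub>W\<^esub> t) [^]\<^bsub>W\<^esub> (group.ord W (t \<otimes>\<^bsub>W\<^esub> u) div 2) \<otimes>\<^bsub>W\<^esub> path_element W (u # \<gamma>)"
| "path_element W _ = \<one>\<^bsub>W\<^esub>"

text \<open>Here the order of \<open>u t\<close>, with \<open>t\<close> the last vertex of \<open>\<gamma>\<close>, is \<open>2 \<lambda>\<close> with \<open>\<lambda> \<ge> 1\<close>.\<close>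

definition path_reflection :: "('a, 'b) monoid_scheme \<Rightarrow> 'a list \<Rightarrow> 'a \<Rightarrow> 'a" where
  "path_reflection W \<gamma> u =
     path_element W \<gamma> \<otimes>\<^bsub>W\<^esub>
     ((u \<otimes>\<^bsub>W\<^esub> last \<gamma>) [^]\<^bsub>W\<^esub> (group.ord W (u \<otimes>\<^bsub>W\<^esub> last \<gamma>) div 2 - 1) \<otimes>\<^bsub>W\<^esub> u) \<otimes>\<^bsub>W\<^esub>
     inv\<^bsub>W\<^esub> (path_element W \<gamma>)"

definition W_Omega :: "('a, 'b) monoid_scheme \<Rightarrow> 'a set \<Rightarrow> 'a \<Rightarrow> 'a set" where
  "W_Omega W S s = generate W (reflections W S \<inter> centralizer W s - {s})"

definition Gamma_Omega :: "('a, 'b) monoid_scheme \<Rightarrow> 'a set \<Rightarrow> 'a \<Rightarrow> 'a set" where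
  "Gamma_Omega W S s = generate W (path_element W ` edge_loops S (oddly_joined W) s)"

text \<open>\<open>Gamma_Omega W S s\<close> normalizes \<open>W_Omega W S s\<close>, and the subgroup generated by the two is
  their internal semidirect product.\<close>

definition W_Gamma_Omega :: "('a, 'b) monoid_scheme \<Rightarrow> 'a set \<Rightarrow> 'a \<Rightarrow> 'a set" where
  "W_Gamma_Omega W S s = generate W (W_Omega W S s \<union> Gamma_Omega W S s)"

end

theory Submission
  imports Defs
begin

text \<open>Let \<open>W\<close> act on \<open>reflections \<times> {+, -}\<close> by conjugation, a generator \<open>u\<close> flipping the sign exactly
  at \<open>u\<close>; the presentation makes this well defined. Let \<open>eta g r\<close> say that \<open>g\<close> flips the
  sign at \<open>r\<close>. A \<open>w\<close> with \<open>w t w\<^sup>-\<^sup>1 = s\<close> (\<open>s, t\<close> generators) that preserves the sign at \<open>t\<close> factors, by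
  induction on its length, into dihedral steps: each strips from the right an element of some \<open>\<langle>t, u\<rangle>\<close> that
  carries \<open>t\<close> to \<open>u\<close> (odd order of \<open>t u\<close>, a step of an edge-path) or to \<open>t\<close> (even order, the local factor of
  a path reflection). Comparing the partial products with a fixed choice of elements that carry each vertex
  to \<open>s\<close> (Schreier's argument) puts every sign-preserving element of the centralizer into the claimed
  subgroup. Reflections other than \<open>s\<close> in the centralizer preserve the sign at \<open>s\<close>, and
  \<open>s\<close> reverses it.\<close>

section \<open>Words and the sign cocycle\<close>

locale coxeter = group W for W (structure) +
  fixes S
  assumes cox: "coxeter_system W S"
begin

lemma mult_inv_cancel [simp]:
  assumes "x \<in> carrier W" "y \<in> carrier W"
  shows "x \<otimes> (inv x \<otimes> y) = y" "inv x \<otimes> (x \<otimes> y) = y"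
  using assms by (simp_all flip: m_assoc)

lemma S_carrier: "x \<in> S \<Longrightarrow> x \<in> carrier W"
  using cox by (auto simp: coxeter_system_def)

lemma S_ord: "x \<in> S \<Longrightarrow> ord x = 2"
  using cox by (auto simp: coxeter_system_def)

lemma S_sq: "x \<in> S \<Longrightarrow> x \<otimes> x = \<one>"
  using pow_ord_eq_1[of x] by (simp add: S_ord S_carrier numeral_2_eq_2)

lemma S_sq_mult: "x \<in> S \<Longrightarrow> y \<in> carrier W \<Longrightarrow> x \<otimes> (x \<otimes> y) = y"
  by (simp add: S_sq S_carrier flip: m_assoc)

lemma S_inv: "x \<in> S \<Longrightarrow> inv x = x"
  by (simp add: S_carrier S_sq inv_equality)

lemma S_neq_one: "x \<in> S \<Longrightarrow> x \<noteq> \<one>"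
  using S_ord by force

lemmas S_simps = S_carrier S_sq S_sq_mult S_inv

section \<open>Conjugation by group elements\<close>

definition conjugate where "conjugate g r = g \<otimes> r \<otimes> inv g"

lemma conjugate_closed [simp]:
  "g \<in> carrier W \<Longrightarrow> r \<in> carrier W \<Longrightarrow> conjugate g r \<in> carrier W"
  by (simp add: conjugate_def)

lemma conjugate_mult:
  "g \<in> carrier W \<Longrightarrow> h \<in> carrier W \<Longrightarrow> r \<in> carrier W \<Longrightarrow>
    conjugate (g \<otimes> h) r = conjugate g (conjugate h r)"
  by (simp add: conjugate_def inv_mult_group m_assoc)

lemma conjugate_one [simp]: "r \<in> carrier W \<Longrightarrow> conjugate \<one> r = r"
  by (simp add: conjugate_def)

lemma conjugate_inv [simp]:
  "g \<in> carrier W \<Longrightarrow> r \<in> carrier W \<Longrightarrow> conjugate (inv g) (conjugate g r) = r"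
  "g \<in> carrier W \<Longrightarrow> r \<in> carrier W \<Longrightarrow> conjugate g (conjugate (inv g) r) = r"
  by (simp_all flip: conjugate_mult)

lemma conjugate_eq_iff:
  assumes "g \<in> carrier W" "r \<in> carrier W" "q \<in> carrier W"
  shows "conjugate g r = q \<longleftrightarrow> r = conjugate (inv g) q"
  using assms by auto

lemma conjugate_self [simp]: "g \<in> carrier W \<Longrightarrow> conjugate g g = g"
  by (simp add: conjugate_def m_assoc)

lemma conjugate_eq_self_iff:
  "g \<in> carrier W \<Longrightarrow> r \<in> carrier W \<Longrightarrow> conjugate g r = g \<longleftrightarrow> r = g"
  by (subst conjugate_eq_iff) (simp_all add: conjugate_def)

lemma conjugate_commute:
  assumes "g \<in> carrier W" "r \<in> carrier W" "q \<in> carrier W"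
  shows "conjugate g r = q \<longleftrightarrow> g \<otimes> r = q \<otimes> g"
  using assms by (metis conjugate_def inv_solve_right m_closed)

section \<open>Unsigned words, their values and their sign changes\<close>

definition wval :: "'a list \<Rightarrow> 'a" where "wval xs = foldr (\<otimes>) xs \<one>"

lemma wval_simps [simp]: "wval [] = \<one>" "wval (x # xs) = x \<otimes> wval xs"
  by (simp_all add: wval_def)

lemma wval_closed [simp]: "xs \<in> lists S \<Longrightarrow> wval xs \<in> carrier W"
  by (induction xs) (auto simp: S_carrier)

lemma wval_append: "xs \<in> lists S \<Longrightarrow> ys \<in> lists S \<Longrightarrow> wval (xs @ ys) = wval xs \<otimes> wval ys"
  by (induction xs) (auto simp: S_carrier m_assoc)

lemma rev_in_lists [simp]: "rev xs \<in> lists A \<longleftrightarrow> xs \<in> lists A"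
  by (auto simp: in_lists_conv_set)

lemma wval_rev: "xs \<in> lists S \<Longrightarrow> wval (rev xs) = inv (wval xs)"
proof (induction xs)
  case (Cons x xs)
  then show ?case
    using wval_append[of "rev xs" "[x]"] by (simp add: S_simps inv_mult_group)
qed simp

text \<open>Words without signs reach every element because each generator is its own
  inverse.\<close>

lemma wval_exists:
  assumes "g \<in> carrier W"
  shows "\<exists>xs \<in> lists S. wval xs = g"
proof -
  have "g \<in> generate W S"
    using cox assms by (simp add: coxeter_system_def presented_by_def)
  then show ?thesis
  proof induction
    case one
    then show ?case by (intro bexI[of _ "[]"]) auto
  next
    case (incl h)
    then show ?case by (intro bexI[of _ "[h]"]) (auto simp: S_simps)
  next
    case (inv h)
    then show ?case by (intro bexI[of _ "[h]"]) (auto simp: S_simps)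
  next
    case (eng g h)
    then obtain xs ys where "xs \<in> lists S" "ys \<in> lists S" "wval xs = g" "wval ys = h" by auto
    then show ?case by (intro bexI[of _ "xs @ ys"]) (auto simp: wval_append)
  qed
qed

text \<open>\<open>cnt xs r\<close> is the number of sign changes along the word \<open>xs\<close> acting, rightmost letter first, at \<open>r\<close>.\<close>

fun cnt :: "'a list \<Rightarrow> 'a \<Rightarrow> nat" where
  "cnt [] r = 0"
| "cnt (x # xs) r = (if conjugate (wval xs) r = x then 1 else 0) + cnt xs r"

lemma cnt_append:
  assumes "xs \<in> lists S" "ys \<in> lists S" "r \<in> carrier W"
  shows "cnt (xs @ ys) r = cnt xs (conjugate (wval ys) r) + cnt ys r"
  using assms by (induction xs) (auto simp: wval_append conjugate_mult)

section \<open>Calculation in the dihedral subgroup of two generators\<close>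

lemma conjugate_rotation:
  assumes "t \<in> S" "u \<in> S"
  shows "conjugate u ((t \<otimes> u) [^] (i::int)) = (t \<otimes> u) [^] (- i)"
proof -
  have c: "t \<otimes> u \<in> carrier W" using assms by (simp add: S_carrier)
  have 1: "conjugate u (t \<otimes> u) = inv (t \<otimes> u)"
    using assms by (simp add: conjugate_def inv_mult_group S_simps m_assoc)
  have hom: "group_hom W W (conjugate u)"
    using assms by unfold_locales (auto simp: hom_def conjugate_def S_simps m_assoc)
  show ?thesis
    using group_hom.hom_int_pow[OF hom c, of i] c by (simp add: 1 int_pow_inv int_pow_neg)
qed

text \<open>\<open>rot t u i\<close> and \<open>u (rot t u i)\<close>, for integral \<open>i\<close>, are all elements of the dihedral group
  \<open>\<langle>t, u\<rangle>\<close>; the latter are its reflections, with \<open>t\<close> at \<open>i = -1\<close> and \<open>u\<close> at \<open>i = 0\<close>.\<close>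

definition rot :: "'a \<Rightarrow> 'a \<Rightarrow> int \<Rightarrow> 'a" where "rot t u i = (t \<otimes> u) [^] i"

context
  fixes t u assumes tu: "t \<in> S" "u \<in> S"
begin

lemma rot_closed [simp]: "rot t u i \<in> carrier W"
  using tu by (simp add: rot_def S_carrier)

lemma rot_mult: "rot t u i \<otimes> rot t u j = rot t u (i + j)"
  using tu by (simp add: rot_def S_carrier int_pow_mult)

lemma rot_inv: "inv (rot t u i) = rot t u (- i)"
  using tu by (simp add: rot_def S_carrier int_pow_neg)

lemma rot_0 [simp]: "rot t u 0 = \<one>"
  by (simp add: rot_def)

lemma rot_u: "rot t u i \<otimes> u = u \<otimes> rot t u (- i)"
proof -
  have "u \<otimes> rot t u (- i) \<otimes> u = rot t u i"
    using conjugate_rotation[OF tu, of "-i"] tu by (simp add: conjugate_def rot_def S_simps)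
  then show ?thesis
    using tu by (metis S_carrier S_sq m_assoc m_closed r_one rot_closed)
qed

lemma t_rot: "t = u \<otimes> rot t u (- 1)"
  using tu rot_u[of 1] by (simp add: rot_def S_simps m_assoc)

lemma t_u_rot: "t \<otimes> u = rot t u 1"
  using tu by (simp add: rot_def S_carrier)

lemma rot_eq_iff: "rot t u i = rot t u j \<longleftrightarrow> int (ord (t \<otimes> u)) dvd (i - j)"
  using tu int_pow_eq[of "t \<otimes> u" i j]  by (simp add: rot_def S_carrier dvd_diff_commute)

lemma ord_commute: "ord (u \<otimes> t) = ord (t \<otimes> u)"
  using ord_inv[of "t \<otimes> u"] tu by (simp add: inv_mult_group S_simps)

lemma u_rot_eq_iff: "u \<otimes> rot t u i = u \<otimes> rot t u j \<longleftrightarrow> int (ord (t \<otimes> u)) dvd (i - j)"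
  using tu by (simp add: S_carrier flip: rot_eq_iff)

text \<open>Pushing \<open>u\<close> to the left past \<open>rot t u i\<close> inverts that
  rotation, and the inverse on the right contributes another \<open>- i\<close>. Indices of
  reflections therefore shift by an even amount.\<close>

lemma conjugate_rot_reflection: "conjugate (rot t u i) (u \<otimes> rot t u j) = u \<otimes> rot t u (j - 2 * i)"
  using tu by (simp add: conjugate_def rot_inv rot_mult S_carrier rot_u m_assoc[symmetric])
     (simp add: m_assoc rot_mult S_carrier)

lemma conjugate_u_reflection: "conjugate u (u \<otimes> rot t u j) = u \<otimes> rot t u (- j)"
  using tu by (simp add: conjugate_def rot_u S_simps m_assoc)

end

text \<open>Read from the right and numbered from 0, the letter number \<open>i\<close> changes the
  sign exactly at \<open>u \<otimes> rot t u i\<close>. If \<open>t \<otimes> u\<close> has finite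
  order, the same reflection can occur at several numbers.\<close>

lemma alternating_count:
  assumes tu: "t \<in> S" "u \<in> S" and r: "r \<in> carrier W"
  shows "cnt (concat (replicate n [t, u])) r = (\<Sum>i<2 * n. if r = u \<otimes> rot t u (int i) then 1 else 0)"
    and "wval (concat (replicate n [t, u])) = rot t u (int n)"
proof -
  have w: "wval (concat (replicate n [t, u])) = rot t u (int n)" for n
  proof (induction n)
    case (Suc n)
    then show ?case
      using tu by (simp add: t_u_rot rot_mult S_carrier flip: m_assoc)
  qed (use tu in simp)
  then show "wval (concat (replicate n [t, u])) = rot t u (int n)" .
  show "cnt (concat (replicate n [t, u])) r = (\<Sum>i<2 * n. if r = u \<otimes> rot t u (int i) then 1 else 0)"
  proof (induction n)
    case (Suc n)
    \<comment> \<open>The two new letters act last: \<open>u\<close> comes after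
      \<open>rot t u n\<close> and has number \<open>2 * n\<close>, and \<open>t\<close> comes next
      with number \<open>2 * n + 1\<close>.\<close>
    have 1: "conjugate (rot t u (int n)) r = u \<longleftrightarrow> r = u \<otimes> rot t u (int (2 * n))"
    proof -
      have "conjugate (rot t u (int n)) r = u \<longleftrightarrow> r = conjugate (rot t u (- int n)) (u \<otimes> rot t u 0)"
        using tu r by (simp add: conjugate_eq_iff S_carrier rot_inv)
      then show ?thesis by (simp only: conjugate_rot_reflection[OF tu]) simp
    qed
    have 2: "conjugate (u \<otimes> rot t u (int n)) r = t \<longleftrightarrow> r = u \<otimes> rot t u (int (2 * n + 1))"
    proof -
      have "conjugate (u \<otimes> rot t u (int n)) r = t \<longleftrightarrow>
          r = conjugate (inv (u \<otimes> rot t u (int n))) (u \<otimes> rot t u (- 1))"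
        using tu r by (simp add: conjugate_eq_iff S_carrier flip: t_rot)
      also have "inv (u \<otimes> rot t u (int n)) = rot t u (- int n) \<otimes> u"
        using tu by (simp add: inv_mult_group rot_inv S_simps)
      also have "conjugate \<dots> (u \<otimes> rot t u (- 1)) = u \<otimes> rot t u (int (2 * n + 1))"
        using tu by (simp add: conjugate_mult S_carrier conjugate_u_reflection conjugate_rot_reflection
            add.commute)
      finally show ?thesis .
    qed
    show ?case
      using Suc 1 2 by (simp add: w)
  qed simp
qed

text \<open>With \<open>m\<close> the order of \<open>t \<otimes> u\<close>, a relator has
  \<open>2 * m\<close> letters, and the reflections numbered \<open>i\<close> and
  \<open>i + m\<close> coincide. The two halves of the count are therefore equal.\<close>

lemma relator_count_even:
  assumes "t \<in> S" "u \<in> S" "r \<in> carrier W"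
  shows "even (cnt (concat (replicate (ord (t \<otimes> u)) [t, u])) r)"
proof -
  define m where "m = ord (t \<otimes> u)"
  define f :: "nat \<Rightarrow> nat" where "f i = (if r = u \<otimes> rot t u (int i) then 1 else 0)" for i
  have per: "f (i + m) = f i" for i
    using assms u_rot_eq_iff[of t u "int (i + m)" "int i"] by (simp add: f_def m_def)
  have "sum f {..<k + m} = sum f {..<k} + sum f {..<m}" for k
  proof (induction k)
    case (Suc k)
    then show ?case using per[of k] by simp
  qed simp
  from this[of m] show ?thesis
    using alternating_count(1)[OF assms, of m] by (simp add: mult_2 flip: m_def f_def)
qed

section \<open>The sign cocycle obtained from the presentation\<close>

lemma word_value_eq: "w \<in> signed_words S \<Longrightarrow> word_value W w = wval (map fst w)"
  by (induction w) (auto simp: S_inv)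

lemma map_fst_signed: "w \<in> signed_words S \<Longrightarrow> map fst w \<in> lists S"
  by (induction w) auto

text \<open>Each elementary rewriting respects both value and parity. The two letters of a cancelled
  pair change the sign together, because conjugation by \<open>x\<close> fixes \<open>x\<close>; a
  relator has value \<open>\<one>\<close> and an even count.\<close>

lemma presentation_equiv_invariant:
  assumes "presentation_equiv S (coxeter_relators W S) v w"
  shows "v \<in> signed_words S \<and> w \<in> signed_words S \<and> wval (map fst v) = wval (map fst w) \<and>
    (\<forall>r \<in> carrier W. even (cnt (map fst v) r) \<longleftrightarrow> even (cnt (map fst w) r))"
  using assms
proof induction
  case (cancel u v x b)
  have "map fst u \<in> lists S" "map fst v \<in> lists S" using cancel map_fst_signed by auto
  with cancel show ?case
    by (auto simp: wval_append cnt_append S_simps conjugate_mult conjugate_eq_self_iff)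
next
  case (relator u v q)
  obtain a c where ac: "a \<in> S" "c \<in> S"
    and q: "q = concat (replicate (ord (a \<otimes> c)) [(a, True), (c, True)])"
    using relator unfolding coxeter_relators_def by blast
  define k where "k = ord (a \<otimes> c)"
  have mq: "map fst q = concat (replicate k [a, c])"
    by (simp add: q map_concat k_def)
  have qs: "q \<in> signed_words S" using ac by (auto simp: q in_lists_conv_set split: if_splits)
  have v1: "wval (map fst q) = \<one>"
    using alternating_count(2)[OF ac one_closed, of k] ac rot_eq_iff[OF ac, of "int k" 0]
    by (simp add: mq k_def)
  have ev: "even (cnt (map fst q) r)" if "r \<in> carrier W" for r
    using relator_count_even[OF ac that] by (simp add: mq k_def)
  have "map fst u \<in> lists S" "map fst v \<in> lists S" "map fst q \<in> lists S"
    using relator qs map_fst_signed by auto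
  with relator qs v1 ev show ?case
    by (auto simp: wval_append cnt_append)
qed auto

text \<open>The presentation enters here: a word of value \<open>\<one>\<close> can be rewritten to
  the empty word, whose count is 0.\<close>

lemma cnt_even_if_one:
  assumes "xs \<in> lists S" "wval xs = \<one>" "r \<in> carrier W"
  shows "even (cnt xs r)"
proof -
  define w where "w = map (\<lambda>x. (x, True)) xs"
  have w: "w \<in> signed_words S" "map fst w = xs"
    using assms(1) by (auto simp: w_def comp_def)
  then have "presentation_equiv S (coxeter_relators W S) w []"
    using cox assms(2) word_value_eq[of w] by (auto simp: coxeter_system_def presented_by_def)
  then show ?thesis
    using presentation_equiv_invariant w assms(3) by fastforce
qed

lemma cnt_parity_well_defined:
  assumes "xs \<in> lists S" "ys \<in> lists S" "wval xs = wval ys" "r \<in> carrier W"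
  shows "odd (cnt xs r) \<longleftrightarrow> odd (cnt ys r)"
proof -
  \<comment> \<open>\<open>q\<close> is the point to which \<open>ys\<close> moves \<open>r\<close>.
    Appending \<open>rev ys\<close> to either word gives a word of value \<open>\<one>\<close>, and
    the contribution of \<open>rev ys\<close> at \<open>q\<close> is common to both.\<close>
  define q where "q = conjugate (wval ys) r"
  have "even (cnt (zs @ rev ys) q)" if "zs \<in> lists S" "wval zs = wval ys" for zs
    using that assms using wval_append[of zs "rev ys"] by (intro cnt_even_if_one) (auto simp: wval_rev q_def)
  from this[of xs] this[of ys] show ?thesis
    using assms by (auto simp: cnt_append wval_rev q_def)
qed

text \<open>The choice of the word is immaterial by \<open>cnt_parity_well_defined\<close>. For a
  reflection \<open>r\<close> this says that \<open>r\<close> is a right inversion of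
  \<open>g\<close>.\<close>

definition eta :: "'a \<Rightarrow> 'a \<Rightarrow> bool" where
  "eta g r \<longleftrightarrow> odd (cnt (SOME xs. xs \<in> lists S \<and> wval xs = g) r)"

lemma eta_wval:
  assumes "xs \<in> lists S" "r \<in> carrier W"
  shows "eta (wval xs) r \<longleftrightarrow> odd (cnt xs r)"
proof -
  define ys where "ys = (SOME ys. ys \<in> lists S \<and> wval ys = wval xs)"
  have "ys \<in> lists S \<and> wval ys = wval xs"
    unfolding ys_def by (rule someI[of _ xs]) (use assms in auto)
  then show ?thesis
    using cnt_parity_well_defined[of ys xs r] assms by (simp add: eta_def ys_def)
qed

text \<open>The cocycle identity: in a concatenated word, the letters of \<open>g\<close> act after
  \<open>h\<close> has moved \<open>r\<close>.\<close>

lemma eta_mult: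
  assumes "g \<in> carrier W" "h \<in> carrier W" "r \<in> carrier W"
  shows "eta (g \<otimes> h) r \<longleftrightarrow> eta g (conjugate h r) \<noteq> eta h r"
proof -
  obtain xs ys where "xs \<in> lists S" "ys \<in> lists S" "wval xs = g" "wval ys = h"
    using wval_exists assms by metis
  then show ?thesis
    using assms eta_wval[of xs "conjugate h r"] eta_wval[of ys r] eta_wval[of "xs @ ys" r]
    by (simp add: wval_append cnt_append)
qed

lemma eta_one [simp]: "r \<in> carrier W \<Longrightarrow> \<not> eta \<one> r"
  using eta_wval[of "[]" r] by simp

lemma eta_generator: "x \<in> S \<Longrightarrow> r \<in> carrier W \<Longrightarrow> eta x r \<longleftrightarrow> r = x"
  using eta_wval[of "[x]" r] by (auto simp: S_carrier)

lemma eta_inv: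
  assumes "g \<in> carrier W" "r \<in> carrier W"
  shows "eta (inv g) (conjugate g r) \<longleftrightarrow> eta g r"
  using eta_mult[of "inv g" g r] assms by simp

text \<open>Apply the cocycle identity to the three factors of \<open>conjugate g u\<close>:
  \<open>inv g\<close> moves \<open>x\<close> to \<open>q\<close>, then \<open>u\<close> acts at
  \<open>q\<close>, and \<open>g\<close> acts at \<open>conjugate u q\<close>.\<close>

lemma eta_conjugate_generator:
  assumes "g \<in> carrier W" "u \<in> S" "x \<in> carrier W"
  defines "q \<equiv> conjugate (inv g) x"
  shows "eta (conjugate g u) x \<longleftrightarrow> (eta g (conjugate u q) \<noteq> (q = u)) \<noteq> eta g q"
proof -
  have q: "q \<in> carrier W" and x: "x = conjugate g q" using assms by simp_all
  have qx: "conjugate (inv g) x = q" by (simp add: q_def)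
  have "eta (inv g) x \<longleftrightarrow> eta g q"
    using eta_inv[of g q] assms(1-3) q by (simp add: x)
  then show ?thesis
    using assms(1-3) q eta_mult[of g "u \<otimes> inv g" x] eta_mult[of u "inv g" x]
    by (simp add: conjugate_def[of g u] m_assoc S_carrier eta_generator conjugate_mult qx) blast
qed

text \<open>Since the reflection fixes \<open>x\<close>, \<open>u\<close> fixes the pulled-back
  point \<open>q\<close>. The contributions of \<open>g\<close> and \<open>inv g\<close> then
  cancel, and that of \<open>u\<close> would require \<open>q = u\<close>, that is
  \<open>conjugate g u = x\<close>.\<close>

lemma eta_reflection_commuting:
  assumes "g \<in> carrier W" "u \<in> S" "x \<in> carrier W"
    and "conjugate (conjugate g u) x = x" "conjugate g u \<noteq> x"
  shows "\<not> eta (conjugate g u) x"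
proof -
  define q where "q = conjugate (inv g) x"
  have q: "q \<in> carrier W" "conjugate g q = x" using assms(1,3) by (simp_all add: q_def)
  have "conjugate (conjugate g u) x = conjugate g (conjugate u q)"
    unfolding conjugate_def[of g u] q_def using assms(1-3) by (simp add: conjugate_mult S_carrier)
  then have "conjugate g (conjugate u q) = x" using assms(4) by simp
  then have "conjugate (inv g) (conjugate g (conjugate u q)) = q" by (simp add: q_def)
  then have "conjugate u q = q" using assms(1,2) q by (simp add: S_carrier)
  moreover have "q \<noteq> u" using assms(5) q(2) by auto
  ultimately show ?thesis
    using eta_conjugate_generator[OF assms(1-3)] by (simp flip: q_def)
qed

section \<open>Strong exchange, length and descents\<close>

lemma exchange:
  assumes "xs \<in> lists S" "r \<in> carrier W" "cnt xs r \<noteq> 0"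
  shows "\<exists>ys. set ys \<subseteq> set xs \<and> length ys < length xs \<and> wval ys = wval xs \<otimes> r"
  using assms
proof (induction xs)
  case (Cons x xs)
  then have x: "x \<in> S" "xs \<in> lists S" by auto
  show ?case
  proof (cases "cnt xs r = 0")
    case True
    \<comment> \<open>Here \<open>x\<close> is the rightmost letter that changes the sign, so right
      multiplication by \<open>r\<close> deletes exactly this letter.\<close>
    then have "conjugate (wval xs) r = x" using Cons by (auto split: if_splits)
    then have "wval xs \<otimes> r = x \<otimes> wval xs"
      using x Cons by (simp add: conjugate_commute S_carrier)
    then have "wval xs = wval (x # xs) \<otimes> r"
      using x Cons by (simp add: S_simps m_assoc)
    then show ?thesis by (intro exI[of _ xs]) auto
  next
    case False
    with Cons x obtain ys where "set ys \<subseteq> set xs" "length ys < length xs" "wval ys = wval xs \<otimes> r"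
      by auto
    then show ?thesis
      using x Cons by (intro exI[of _ "x # ys"]) (auto simp: m_assoc S_carrier)
  qed
qed simp

text \<open>The length is relative to \<open>J\<close> so that it serves both \<open>W\<close> and
  its dihedral subgroups. If \<open>g\<close> has no word over \<open>J\<close>, the
  \<open>LEAST\<close> is unspecified; this is why lemmas for general \<open>J\<close> speak of
  \<open>wval xs\<close> with \<open>xs\<close> over \<open>J\<close>.\<close>

definition len :: "'a set \<Rightarrow> 'a \<Rightarrow> nat" where
  "len J g = (LEAST n. \<exists>xs \<in> lists J. wval xs = g \<and> length xs = n)"

lemma len_le: "xs \<in> lists J \<Longrightarrow> len J (wval xs) \<le> length xs"
  unfolding len_def by (rule Least_le) auto

lemma len_attained: "xs \<in> lists J \<Longrightarrow> \<exists>ys \<in> lists J. wval ys = wval xs \<and> length ys = len J (wval xs)"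
  unfolding len_def by (rule LeastI[of _ "length xs"]) auto

text \<open>An odd count is nonzero, so \<open>exchange\<close> shortens a shortest word, and the
  shorter word still uses only letters of \<open>J\<close>.\<close>

lemma len_less:
  assumes "J \<subseteq> S" "xs \<in> lists J" "r \<in> carrier W" "eta (wval xs) r"
  shows "len J (wval xs \<otimes> r) < len J (wval xs)"
proof -
  obtain ys where ys: "ys \<in> lists J" "wval ys = wval xs" "length ys = len J (wval xs)"
    using len_attained[OF assms(2)] by blast
  moreover have ysS: "ys \<in> lists S" using ys(1) lists_mono[OF assms(1)] by blast
  ultimately have "cnt ys r \<noteq> 0"
    using eta_wval[of ys r] assms by (intro notI) simp
  then obtain zs where "set zs \<subseteq> set ys" "length zs < length ys" "wval zs = wval ys \<otimes> r"
    using exchange[OF ysS assms(3)] by blast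
  moreover then have "zs \<in> lists J" using ys(1) by (auto simp: in_lists_conv_set)
  ultimately show ?thesis using len_le[of zs J] ys(2,3) by simp
qed

text \<open>The last letter \<open>x\<close> of a shortest word \<open>zs @ [x]\<close> will do.
  Otherwise \<open>zs\<close> would change the sign at \<open>x\<close>, and \<open>len_less\<close>
  would make the whole word shorter than \<open>zs\<close>.\<close>

lemma descent_exists:
  assumes "J \<subseteq> S" "xs \<in> lists J" "wval xs \<noteq> \<one>"
  shows "\<exists>x \<in> J. eta (wval xs) x"
proof -
  obtain ys where ys: "ys \<in> lists J" "wval ys = wval xs" "length ys = len J (wval xs)"
    using len_attained[OF assms(2)] by blast
  then have "ys \<noteq> []" using assms by auto
  then obtain zs x where zs: "ys = zs @ [x]" by (metis rev_exhaust)
  have x: "x \<in> J" "zs \<in> lists J" using ys(1) zs by simp_all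
  then have xS: "x \<in> S" "zs \<in> lists S" using assms(1) lists_mono[OF assms(1)] by blast+
  then have v: "wval ys = wval zs \<otimes> x" "wval zs = wval ys \<otimes> x"
    by (simp_all add: zs wval_append xS S_simps m_assoc)
  have "eta (wval ys) x"
  proof (rule ccontr)
    assume "\<not> eta (wval ys) x"
    then have "eta (wval zs) x"
      using xS v(1) eta_mult[of "wval zs" x x] by (simp add: S_carrier eta_generator)
    then have "len J (wval ys) < len J (wval zs)"
      using len_less[of J zs x] x xS assms(1) v(1) by (simp add: S_carrier)
    moreover have "len J (wval zs) \<le> length zs" using x(2) by (rule len_le)
    ultimately show False using ys(2,3) zs by simp
  qed
  then show ?thesis using x(1) ys(2) by auto
qed

section \<open>Transporting one generator to another\<close>

lemma dihedral_elements:
  assumes tu: "t \<in> S" "u \<in> S" and "zs \<in> lists {t, u}"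
  shows "\<exists>i. wval zs = rot t u i \<or> wval zs = u \<otimes> rot t u i"
  using assms(3)
proof (induction zs)
  case Nil
  show ?case using tu by (intro exI[of _ 0]) simp
next
  case (Cons x zs)
  then obtain i where i: "wval zs = rot t u i \<or> wval zs = u \<otimes> rot t u i" by auto
  have t: "t \<otimes> rot t u i = u \<otimes> rot t u (i - 1)"
    using tu by (subst t_rot[OF tu]) (simp add: m_assoc rot_mult S_carrier)
  have tu': "t \<otimes> (u \<otimes> rot t u i) = rot t u (i + 1)"
    using tu t_u_rot[OF tu] by (simp add: rot_mult S_carrier add.commute flip: m_assoc)
  have uu: "u \<otimes> (u \<otimes> rot t u i) = rot t u i" using tu by (simp add: S_simps)
  from Cons.hyps have "x = t \<or> x = u" by auto
  then show ?case using i t tu' uu by (elim disjE) (simp; blast)+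
qed

text \<open>Only \<open>m - 1\<close> and \<open>2 * m - 1\<close> qualify below
  \<open>2 * m\<close>, and the strict bound on \<open>k\<close> excludes the latter. The condition
  marks the occurrences of \<open>t = u \<otimes> rot t u (- 1)\<close> in an alternating
  word.\<close>

lemma count_residue:
  fixes m k :: nat
  assumes "k < 2 * m"
  shows "(\<Sum>i<k. if m dvd i + 1 then 1 else (0::nat)) = (if k < m then 0 else 1)"
proof -
  have "m dvd i + 1 \<longleftrightarrow> i = m - 1" if i: "i < k" for i
  proof
    assume "m dvd i + 1"
    then obtain c where c: "i + 1 = m * c" by blast
    then have "m * c < m * 2 + 0 \<or> m * c = m * 2" using i assms by linarith
    moreover have "m * c \<noteq> m * 2" using i c assms by linarith
    ultimately have "c < 2" by simp
    moreover have "c \<noteq> 0" using c by (intro notI) simp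
    ultimately have "c = 1" by simp
    then show "i = m - 1" using c by simp
  qed (use assms in simp)
  then have "(\<Sum>i<k. if m dvd i + 1 then 1 else (0::nat)) = (\<Sum>i<k. if i = m - 1 then 1 else 0)"
    by (intro sum.cong) auto
  then show ?thesis using assms by auto
qed

text \<open>With \<open>m\<close> the order of \<open>t \<otimes> u\<close>, an alternating word
  ending in \<open>u\<close> first meets \<open>t\<close> at letter number \<open>m - 1\<close>, and
  only once among fewer than \<open>2 * m\<close> letters. The two elements have such words of
  lengths \<open>2 * n\<close> and \<open>2 * n + 1\<close>.\<close>

lemma eta_rotation:
  assumes tu: "t \<in> S" "u \<in> S" and n: "n < ord (t \<otimes> u)"
  shows "eta (rot t u (int n)) t \<longleftrightarrow> ord (t \<otimes> u) \<le> 2 * n"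
    and "eta (u \<otimes> rot t u (int n)) t \<longleftrightarrow> ord (t \<otimes> u) \<le> 2 * n + 1"
proof -
  define m where "m = ord (t \<otimes> u)"
  define f :: "nat \<Rightarrow> nat" where "f i = (if m dvd i + 1 then 1 else 0)" for i
  have tc: "t \<in> carrier W" "u \<in> carrier W" using tu by (simp_all add: S_carrier)
  have reflection_iff: "t = u \<otimes> rot t u (int i) \<longleftrightarrow> m dvd i + 1" for i
  proof -
    have "t = u \<otimes> rot t u (int i) \<longleftrightarrow> u \<otimes> rot t u (int i) = u \<otimes> rot t u (- 1)"
      using t_rot[OF tu] by metis
    also have "\<dots> \<longleftrightarrow> int m dvd int (i + 1)"
      using u_rot_eq_iff[OF tu, of "int i" "- 1"] by (simp add: m_def add.commute)
    finally show ?thesis by (simp only: int_dvd_int_iff)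
  qed
  define ws where "ws = concat (replicate n [t, u])"
  have ws: "ws \<in> lists S" using tu by (auto simp: ws_def in_lists_conv_set split: if_splits)
  have c1: "cnt ws t = sum f {..<2 * n}" and v: "wval ws = rot t u (int n)"
    using alternating_count[OF tu tc(1), of n] by (simp_all add: ws_def f_def reflection_iff)
  \<comment> \<open>The extra \<open>u\<close> on the left is letter number
    \<open>2 * n\<close>.\<close>
  have "conjugate (rot t u (int n)) t = u \<longleftrightarrow> m dvd 2 * n + 1"
  proof -
    have "conjugate (rot t u (int n)) t = u \<otimes> rot t u (- 1 - 2 * int n)"
      using conjugate_rot_reflection[OF tu, of "int n" "- 1"] by (simp flip: t_rot[OF tu])
    then have "conjugate (rot t u (int n)) t = u \<longleftrightarrow>
        u \<otimes> rot t u (- 1 - 2 * int n) = u \<otimes> rot t u 0"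
      using tc tu by simp
    also have "\<dots> \<longleftrightarrow> int m dvd - int (2 * n + 1)"
      using u_rot_eq_iff[OF tu, of "- 1 - 2 * int n" 0] by (simp add: m_def)
    finally show ?thesis by (simp only: dvd_minus_iff int_dvd_int_iff)
  qed
  then have c2: "cnt (u # ws) t = sum f {..<2 * n + 1}"
    by (simp add: c1 v f_def)
  have "2 * n < 2 * m" "2 * n + 1 < 2 * m" using n by (simp_all add: m_def)
  then have s: "sum f {..<2 * n} = (if 2 * n < m then 0 else 1)"
      "sum f {..<2 * n + 1} = (if 2 * n + 1 < m then 0 else 1)"
    unfolding f_def by (simp_all only: count_residue)
  show "eta (rot t u (int n)) t \<longleftrightarrow> ord (t \<otimes> u) \<le> 2 * n"
    using eta_wval[OF ws tc(1)] s(1) by (simp add: v c1 flip: m_def)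
  have uws: "u # ws \<in> lists S" using ws tu by simp
  have "odd (sum f {..<2 * n + 1}) \<longleftrightarrow> m \<le> 2 * n + 1" unfolding s(2) by auto
  then show "eta (u \<otimes> rot t u (int n)) t \<longleftrightarrow> ord (t \<otimes> u) \<le> 2 * n + 1"
    using eta_wval[OF uws tc(1)] unfolding c2 wval_simps v m_def by blast
qed

text \<open>Both conditions become conditions on the exponent \<open>n\<close> of \<open>d\<close>,
  reduced modulo \<open>m\<close>. For a rotation the sign gives \<open>2 * n < m\<close> and the
  transport gives \<open>m dvd 2 * n + 1\<close>, so \<open>m = 2 * n + 1\<close>. For a reflection
  they give \<open>2 * n + 1 < m\<close> and \<open>m dvd 2 * n + 2\<close>, so
  \<open>m = 2 * n + 2\<close>.\<close>

lemma dihedral_transporter: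
  assumes tu: "t \<in> S" "u \<in> S" and zs: "zs \<in> lists {t, u}" and d: "d = wval zs"
    and "d \<noteq> \<one>" "\<not> eta d t" "conjugate d t \<in> {t, u}"
  defines "m \<equiv> ord (t \<otimes> u)"
  shows "(odd m \<and> d = rot t u (int (m div 2)) \<and> conjugate d t = u) \<or>
    (m \<noteq> 0 \<and> even m \<and> d = u \<otimes> rot t u (int (m div 2 - 1)) \<and> conjugate d t = t)"
proof -
  have tc: "t \<in> carrier W" "u \<in> carrier W" using tu by (simp_all add: S_carrier)
  have is_t: "u \<otimes> rot t u j = t \<longleftrightarrow> int m dvd j + 1" for j
    using u_rot_eq_iff[OF tu, of j "- 1"] by (simp add: m_def flip: t_rot[OF tu])
  have is_u: "u \<otimes> rot t u j = u \<longleftrightarrow> int m dvd j" for j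
    using u_rot_eq_iff[OF tu, of j 0] tc tu by (simp add: m_def)
  obtain i where "d = rot t u i \<or> d = u \<otimes> rot t u i"
    using dihedral_elements[OF tu zs] d by blast
  then show ?thesis
  proof
    assume di: "d = rot t u i"
    have cd: "conjugate (rot t u j) t = u \<otimes> rot t u (- 1 - 2 * j)" for j
      using conjugate_rot_reflection[OF tu, of j "- 1"] by (simp flip: t_rot[OF tu])
    have rel: "int m dvd - 2 * i \<or> int m dvd - 1 - 2 * i"
      using assms(7) is_t[of "- 1 - 2 * i"] is_u[of "- 1 - 2 * i"] by (auto simp: di cd)
    have "i \<noteq> 0" using assms(5) di tu by auto
    \<comment> \<open>For infinite order the divisibility becomes an equation, whose only integral
      solution is \<open>i = 0\<close>, the excluded \<open>d = \<one>\<close>.\<close>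
    have "m \<noteq> 0"
    proof
      assume "m = 0"
      then have "- 2 * i = 0 \<or> - 1 - 2 * i = 0" using rel by simp
      with \<open>i \<noteq> 0\<close> show False by presburger
    qed
    \<comment> \<open>The exponent is brought into the range that \<open>eta_rotation\<close>
      requires.\<close>
    define n where "n = nat (i mod int m)"
    have n: "n < m" "int n = i mod int m" using \<open>m \<noteq> 0\<close> by (simp_all add: n_def nat_less_iff)
    have dn: "d = rot t u (int n)"
      unfolding di n(2) rot_eq_iff[OF tu] m_def[symmetric] by (simp add: mod_eq_dvd_iff[symmetric])
    have "2 * n < m"
      using eta_rotation(1)[OF tu, of n] n(1) assms(6) by (simp add: dn m_def)
    moreover have "n \<noteq> 0" using assms(5) dn tu by (intro notI) simp
    ultimately have "\<not> m dvd 2 * n" by (auto dest: dvd_imp_le)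
    have "int m dvd - 2 * int n \<or> int m dvd - 1 - 2 * int n"
      using assms(7) is_t[of "- 1 - 2 * int n"] is_u[of "- 1 - 2 * int n"] by (auto simp: dn cd)
    moreover have "int m dvd - 2 * int n \<longleftrightarrow> m dvd 2 * n"
      using int_dvd_int_iff[of m "2 * n"] by simp
    moreover have eq: "- 1 - 2 * int n = - int (2 * n + 1)" by simp
    moreover have "int m dvd - int (2 * n + 1) \<longleftrightarrow> m dvd 2 * n + 1"
      by (simp only: dvd_minus_iff int_dvd_int_iff)
    ultimately have "m dvd 2 * n + 1" using \<open>\<not> m dvd 2 * n\<close> by metis
    then have m: "m = 2 * n + 1" using \<open>2 * n < m\<close> by (auto dest: dvd_imp_le)
    have "int m dvd - 1 - 2 * int n" unfolding eq m dvd_minus_iff by (rule dvd_refl)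
    then have "conjugate d t = u" unfolding dn cd is_u .
    then show ?thesis using dn m by simp
  next
    assume di: "d = u \<otimes> rot t u i"
    have cd: "conjugate (u \<otimes> rot t u j) t = u \<otimes> rot t u (1 + 2 * j)" for j
      using conjugate_rot_reflection[OF tu, of j "- 1"] conjugate_u_reflection[OF tu, of "- 1 - 2 * j"] tc tu
      by (simp add: conjugate_mult add.commute flip: t_rot[OF tu])
    have rel: "int m dvd 2 + 2 * i \<or> int m dvd 1 + 2 * i"
      using assms(7) is_t[of "1 + 2 * i"] is_u[of "1 + 2 * i"] unfolding di cd by auto
    \<comment> \<open>Exponent \<open>- 1\<close> would make \<open>d\<close> equal to
      \<open>t\<close>, which changes the sign at itself.\<close>
    have "i \<noteq> - 1"
      using assms(6) di t_rot[OF tu] eta_generator[OF tu(1) tc(1)] by auto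
    have "m \<noteq> 0"
    proof
      assume "m = 0"
      then have "2 + 2 * i = 0 \<or> 1 + 2 * i = 0" using rel by simp
      with \<open>i \<noteq> - 1\<close> show False by presburger
    qed
    define n where "n = nat (i mod int m)"
    have n: "n < m" "int n = i mod int m" using \<open>m \<noteq> 0\<close> by (simp_all add: n_def nat_less_iff)
    have dn: "d = u \<otimes> rot t u (int n)"
      unfolding di n(2) u_rot_eq_iff[OF tu] m_def[symmetric] by (simp add: mod_eq_dvd_iff[symmetric])
    have lt: "2 * n + 1 < m"
      using eta_rotation(2)[OF tu, of n] n(1) assms(6) by (simp add: dn m_def)
    then have nd: "\<not> m dvd 2 * n + 1" by (intro notI) (auto dest: dvd_imp_le)
    have "int m dvd 2 + 2 * int n \<or> int m dvd 1 + 2 * int n"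
      using assms(7) is_t[of "1 + 2 * int n"] is_u[of "1 + 2 * int n"] unfolding dn cd by auto
    moreover have eq: "2 + 2 * int n = int (2 * n + 2)" "1 + 2 * int n = int (2 * n + 1)" by simp_all
    ultimately have "m dvd 2 * n + 2" using nd by (metis int_dvd_int_iff)
    then have "m \<le> 2 * n + 2" by (intro dvd_imp_le) simp_all
    then have m: "m = 2 * n + 2" using lt by simp
    have "int m dvd 1 + 2 * int n + 1" by (simp add: m)
    then have "conjugate d t = t" unfolding dn cd is_t .
    then show ?thesis using dn m by simp
  qed
qed

section \<open>Minimal coset representatives and Schreier's argument\<close>

lemma len_less_S:
  assumes "g \<in> carrier W" "r \<in> carrier W" "eta g r"
  shows "len S (g \<otimes> r) < len S g"
  using len_less[OF order_refl] wval_exists assms by metis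

text \<open>The key decomposition: strip from \<open>w\<close> its right factor \<open>d\<close> in a dihedral parabolic subgroup
  \<open>\<langle>t, u\<rangle>\<close>. Minimality of the rest \<open>w'\<close> forces \<open>d t d\<^sup>-\<^sup>1\<close> to be \<open>t\<close> or \<open>u\<close>.\<close>

lemma strip_dihedral:
  assumes w: "w \<in> carrier W" and tS: "t \<in> S" and sS: "s \<in> S"
    and wt: "conjugate w t = s" and not_eta: "\<not> eta w t" and "w \<noteq> \<one>"
  obtains u w' d zs where "u \<in> S" "u \<noteq> t" "w' \<in> carrier W" "zs \<in> lists {t, u}" "d = wval zs"
    "w = w' \<otimes> d" "d \<noteq> \<one>" "\<not> eta d t" "conjugate d t \<in> {t, u}" "len S w' < len S w"
    "\<not> eta w' (conjugate d t)"
proof -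
  obtain u where u: "u \<in> S" "eta w u"
    using descent_exists[OF order_refl] wval_exists[OF w] \<open>w \<noteq> \<one>\<close> by metis
  have ut: "u \<noteq> t" using u not_eta by auto
  have tc: "t \<in> carrier W" "u \<in> carrier W" "s \<in> carrier W" using tS sS u by (simp_all add: S_carrier)
  have sub: "lists {t, u} \<subseteq> lists S" using tS u by (intro lists_mono) simp
  \<comment> \<open>The minimum is taken over the coset of \<open>w\<close> by the dihedral
    subgroup; \<open>P\<close> only gives the predicate a name for
    \<open>ex_has_least_nat\<close>.\<close>
  define P where "P ys \<longleftrightarrow> ys \<in> lists {t, u}" for ys :: "'a list"
  have "P [u]" by (simp add: P_def)
  from ex_has_least_nat[of P "[u]" "\<lambda>ys. len S (w \<otimes> wval ys)", OF this]
  obtain ys where ys: "ys \<in> lists {t, u}"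
    and least: "\<And>zs. zs \<in> lists {t, u} \<Longrightarrow> len S (w \<otimes> wval ys) \<le> len S (w \<otimes> wval zs)"
    by (auto simp: P_def)
  have ysS: "ys \<in> lists S" using ys sub by blast
  define w' where "w' = w \<otimes> wval ys"
  define d where "d = wval (rev ys)"
  have dc: "d \<in> carrier W" and w'c: "w' \<in> carrier W" using ysS w by (simp_all add: d_def w'_def)
  have w_eq: "w = w' \<otimes> d" using ysS w by (simp add: w'_def d_def wval_rev m_assoc)
  \<comment> \<open>Comparison with \<open>[u]\<close>, where \<open>u\<close> is a descent of
    \<open>w\<close>, makes the drop in length strict.\<close>
  have "len S w' \<le> len S (w \<otimes> wval [u])" using least[of "[u]"] by (simp add: w'_def)
  also have "\<dots> < len S w" using len_less_S[OF w tc(2) u(2)] tc by simp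
  finally have len: "len S w' < len S w" .
  \<comment> \<open>By minimality \<open>w'\<close> changes no sign at any element of the dihedral
    subgroup, since such a change would yield a shorter element of the coset.\<close>
  have min: "\<not> eta w' (wval zs)" if zs: "zs \<in> lists {t, u}" for zs
  proof
    have zsS: "zs \<in> lists S" using zs sub by blast
    assume "eta w' (wval zs)"
    then have "len S (w' \<otimes> wval zs) < len S w'" using len_less_S w'c zsS by simp
    moreover have "w' \<otimes> wval zs = w \<otimes> wval (ys @ zs)"
      using w ysS zsS by (simp add: w'_def wval_append m_assoc)
    ultimately show False using least[of "ys @ zs"] ys zs by (simp add: w'_def)
  qed
  define r where "r = conjugate d t"
  define rs where "rs = rev ys @ [t] @ ys"
  have rs: "rs \<in> lists {t, u}" "rs \<in> lists S" using ys ysS tS by (simp_all add: rs_def)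
  have rw: "r = wval rs"
    using ysS tS tc by (simp add: r_def rs_def d_def conjugate_def wval_append wval_rev m_assoc)
  have rc: "r \<in> carrier W" using tc dc by (simp add: r_def)
  have "t = conjugate (inv d) r" using dc tc by (simp add: r_def)
  then have "r \<noteq> \<one>" using S_neq_one[OF tS] dc by (intro notI) (simp add: conjugate_def)
  have w'r: "conjugate w' r = s" using wt w_eq w'c dc tc by (simp add: r_def conjugate_mult)
  have comm: "s \<otimes> w' = w' \<otimes> r" using w'r w'c rc tc by (simp add: conjugate_commute)
  \<comment> \<open>Evaluate \<open>eta\<close> at \<open>x\<close> on both sides of
    \<open>s \<otimes> w' = w' \<otimes> r\<close>. By \<open>min\<close> the factor
    \<open>w'\<close> contributes nothing on either side, and \<open>s\<close> contributes exactly
    when \<open>w'\<close> carries \<open>x\<close> to \<open>s\<close>, that is for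
    \<open>x = r\<close>.\<close>
  have only: "eta r x \<longleftrightarrow> x = r" if "x = wval zs" "zs \<in> lists {t, u}" for x zs
  proof -
    have zsS: "zs \<in> lists S" using that(2) sub by blast
    have xc: "x \<in> carrier W" using zsS that(1) by simp
    have "conjugate r x = wval (rs @ zs @ rev rs)"
      using rs zsS by (simp add: that(1) rw conjugate_def wval_append wval_rev m_assoc)
    then have "\<not> eta w' (conjugate r x)" using min[of "rs @ zs @ rev rs"] rs that by simp
    then have "eta (w' \<otimes> r) x \<longleftrightarrow> eta r x" using eta_mult[OF w'c rc xc] by simp
    moreover have "eta (s \<otimes> w') x \<longleftrightarrow> conjugate w' x = s"
      using eta_mult[OF tc(3) w'c xc] eta_generator[OF sS, of "conjugate w' x"] min[OF that(2)] that(1) xc w'c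
      by simp
    moreover have "conjugate w' x = s \<longleftrightarrow> x = r"
      using conjugate_eq_iff[OF w'c xc tc(3)] conjugate_eq_iff[OF w'c rc tc(3)] w'r by auto
    ultimately show ?thesis using comm by simp
  qed
  \<comment> \<open>\<open>r\<close> has a descent among \<open>t\<close> and \<open>u\<close>; by
    \<open>only\<close> this descent is \<open>r\<close> itself.\<close>
  obtain x where x: "x \<in> {t, u}" "eta r x"
    using descent_exists[of "{t, u}" rs] rs(1) rw \<open>r \<noteq> \<one>\<close> tS u by auto
  then have "x = r" using only[of x "[x]"] tc by auto
  then have rtu: "conjugate d t \<in> {t, u}" using x(1) by (simp add: r_def)
  have not_eta_r: "\<not> eta w' r" using min[OF rs(1)] rw by simp
  then have "\<not> eta d t" using not_eta eta_mult[OF w'c dc tc(1)] w_eq by (simp add: r_def)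
  moreover have "d \<noteq> \<one>" using len w_eq w'c by auto
  ultimately show thesis
    using that[OF u(1) ut w'c, of "rev ys" d] ys d_def w_eq rtu len not_eta_r by (simp add: r_def)
qed

text \<open>Schreier's argument by induction on length. The element \<open>q t\<close> stands for
  the chosen path element of \<open>t\<close>; the step hypotheses say that the Schreier generators
  for odd edges and for even pairs lie in \<open>H\<close>. The condition \<open>q s \<in> H\<close>
  takes the place of \<open>q s = \<one>\<close>, since the chosen path at \<open>s\<close> may be
  any loop.\<close>

lemma transporter_in_coset:
  assumes sS: "s \<in> S" and H: "subgroup H W" and V: "s \<in> V" "q s \<in> H"
    and q: "\<And>t. t \<in> V \<Longrightarrow> q t \<in> carrier W"
    and odd_step: "\<And>t u. u \<in> V \<Longrightarrow> t \<in> S \<Longrightarrow> oddly_joined W u t \<Longrightarrow>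
      t \<in> V \<and> q u \<otimes> path_element W [u, t] \<otimes> inv (q t) \<in> H"
    and even_step: "\<And>t u. t \<in> V \<Longrightarrow> u \<in> S \<Longrightarrow> evenly_joined W t u \<Longrightarrow>
      q t \<otimes> ((u \<otimes> t) [^] (ord (u \<otimes> t) div 2 - 1) \<otimes> u) \<otimes> inv (q t) \<in> H"
    and "w \<in> carrier W" "t \<in> S" "conjugate w t = s" "\<not> eta w t"
  shows "t \<in> V \<and> w \<otimes> inv (q t) \<in> H"
  using assms(8-)
proof (induction "len S w" arbitrary: w t rule: less_induct)
  case less
  have tc: "t \<in> carrier W" using less.prems by (simp add: S_carrier)
  show ?case
  proof (cases "w = \<one>")
    case True
    then have "t = s" using less.prems tc by simp
    then show ?thesis using V H True q by (simp add: subgroup.m_inv_closed)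
  next
    case False
    obtain u w' d zs where u: "u \<in> S" "u \<noteq> t" and w': "w' \<in> carrier W"
      and zs: "zs \<in> lists {t, u}" "d = wval zs" and w: "w = w' \<otimes> d" and "d \<noteq> \<one>" "\<not> eta d t"
      and tu: "conjugate d t \<in> {t, u}" and len: "len S w' < len S w"
      and not_eta: "\<not> eta w' (conjugate d t)"
      using strip_dihedral[OF less.prems(1,2) sS less.prems(3,4) False] by metis
    have uc: "u \<in> carrier W" using u by (simp add: S_carrier)
    have dc: "d \<in> carrier W" using lists_mono[of "{t, u}" S] zs u less.prems(2) wval_closed by blast
    have "conjugate w' (conjugate d t) = s"
      using less.prems(3) w w' dc tc by (simp add: conjugate_mult)
    moreover have "conjugate d t \<in> S" using tu u less.prems(2) by auto
    ultimately have IH: "conjugate d t \<in> V" "w' \<otimes> inv (q (conjugate d t)) \<in> H"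
      using less.hyps[OF len w'] not_eta by auto
    \<comment> \<open>Telescoping: \<open>inv (q x)\<close> and \<open>q x\<close> cancel between
      the part known by induction and the Schreier generator; \<open>x\<close> will be
      \<open>conjugate d t\<close>.\<close>
    have step: "w \<otimes> inv (q t) \<in> H"
      if "x \<in> V" "t \<in> V" "w' \<otimes> inv (q x) \<in> H" "q x \<otimes> d \<otimes> inv (q t) \<in> H" for x
    proof -
      have "(w' \<otimes> inv (q x)) \<otimes> (q x \<otimes> d \<otimes> inv (q t)) = w \<otimes> inv (q t)"
        using that q w' dc by (simp add: w m_assoc)
      then show ?thesis using subgroup.m_closed[OF H that(3,4)] by simp
    qed
    note ord_ut = ord_commute[OF less.prems(2) u(1)]
    from dihedral_transporter[OF less.prems(2) u(1) zs \<open>d \<noteq> \<one>\<close> \<open>\<not> eta d t\<close> tu]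
    show ?thesis
    proof (elim disjE conjE)
      assume odd: "odd (ord (t \<otimes> u))" and d: "d = rot t u (int (ord (t \<otimes> u) div 2))"
        and du: "conjugate d t = u"
      \<comment> \<open>The edge runs from \<open>u\<close> to \<open>t\<close>, because
        \<open>d\<close> carries \<open>t\<close> back to \<open>u\<close>.\<close>
      have "oddly_joined W u t" using odd u by (simp add: oddly_joined_def ord_ut)
      moreover have "path_element W [u, t] = d"
        using tc uc by (simp add: d rot_def ord_ut int_pow_int)
      ultimately show ?thesis
        using odd_step[of u t] less.prems(2) IH step[of u] by (simp add: du)
    next
      assume ev: "ord (t \<otimes> u) \<noteq> 0" "even (ord (t \<otimes> u))"
        and d: "d = u \<otimes> rot t u (int (ord (t \<otimes> u) div 2 - 1))" and dt: "conjugate d t = t"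
      have tV: "t \<in> V" using IH dt by simp
      have "evenly_joined W t u" using ev u by (simp add: evenly_joined_def)
      \<comment> \<open>The same alternating word, grouped from the other end.\<close>
      moreover have "(u \<otimes> t) [^] (ord (u \<otimes> t) div 2 - 1) \<otimes> u = d"
        using less.prems(2) u(1) rot_u[OF less.prems(2) u(1), of "- int (ord (t \<otimes> u) div 2 - 1)"]
          int_pow_inv[of "t \<otimes> u" "int (ord (t \<otimes> u) div 2 - 1)"]
        by (simp add: d ord_ut rot_def int_pow_neg int_pow_int inv_mult_group S_simps flip: nat_pow_inv)
      ultimately show ?thesis
        using even_step[OF tV u(1)] step[OF tV tV] IH tV by (simp add: dt)
    qed
  qed
qed

end

section \<open>The fundamental group of a graph\<close>

lemma edge_path_append:
  assumes "edge_path V E x y \<alpha>" "edge_path V E y z \<beta>"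
  shows "edge_path V E x z (\<alpha> @ tl \<beta>)"
proof -
  obtain \<beta>' where "\<beta> = y # \<beta>'" using assms(2) by (cases \<beta>) (auto simp: edge_path_def)
  then show ?thesis using assms
    by (cases \<beta>') (auto simp: edge_path_def successively_append_iff)
qed

lemma edge_path_rev:
  assumes "symp_on V E" "edge_path V E x y \<gamma>"
  shows "edge_path V E y x (rev \<gamma>)"
proof -
  have "successively (\<lambda>a b. E b a) \<gamma>"
    using assms by (auto simp: edge_path_def intro: successively_mono symp_onD)
  then show ?thesis using assms by (auto simp: edge_path_def hd_rev last_rev)
qed

lemma backtrack_in_loops:
  "\<alpha> @ [t, u, t] @ \<beta> \<in> edge_loops V E x \<Longrightarrow> \<alpha> @ [t] @ \<beta> \<in> edge_loops V E x"
  by (cases \<beta>) (auto simp: edge_loops_def edge_path_def successively_append_iff hd_append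
      split: if_splits)

lemma loop_homotopic_loops:
  "loop_homotopic V E x \<gamma> \<gamma>' \<Longrightarrow> \<gamma> \<in> edge_loops V E x \<and> \<gamma>' \<in> edge_loops V E x"
  by (induction rule: loop_homotopic.induct) (simp_all only: backtrack_in_loops simp_thms)

lemma append_loop:
  "\<alpha> \<in> edge_loops V E x \<Longrightarrow> \<beta> \<in> edge_loops V E x \<Longrightarrow> \<alpha> @ tl \<beta> \<in> edge_loops V E x"
  by (auto simp: edge_loops_def intro: edge_path_append)

lemma loop_homotopic_append_right:
  assumes "loop_homotopic V E x \<gamma> \<gamma>'" "\<beta> \<in> edge_loops V E x"
  shows "loop_homotopic V E x (\<gamma> @ tl \<beta>) (\<gamma>' @ tl \<beta>)"
  using assms
proof (induction rule: loop_homotopic.induct)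
  case (refl \<gamma>)
  then show ?case by (intro loop_homotopic.refl append_loop)
next
  case (sym \<gamma> \<gamma>')
  then show ?case by (blast intro: loop_homotopic.sym)
next
  case (trans \<gamma> \<gamma>' \<gamma>'')
  then show ?case by (blast intro: loop_homotopic.trans)
next
  case (backtrack \<alpha> t u \<delta>)
  then show ?case
    using append_loop[OF backtrack] loop_homotopic.backtrack[of \<alpha> t u "\<delta> @ tl \<beta>"] by simp
qed

lemma loop_homotopic_append_left:
  assumes "loop_homotopic V E x \<gamma> \<gamma>'" "\<beta> \<in> edge_loops V E x"
  shows "loop_homotopic V E x (\<beta> @ tl \<gamma>) (\<beta> @ tl \<gamma>')"
  using assms
proof (induction rule: loop_homotopic.induct)
  case (refl \<gamma>)
  then show ?case by (intro loop_homotopic.refl append_loop)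
next
  case (sym \<gamma> \<gamma>')
  then show ?case by (blast intro: loop_homotopic.sym)
next
  case (trans \<gamma> \<gamma>' \<gamma>'')
  then show ?case by (blast intro: loop_homotopic.trans)
next
  case (backtrack \<alpha> t u \<delta>)
  note loop = append_loop[OF backtrack(2,1)]
  show ?case
  proof (cases \<alpha>)
    case Nil
    \<comment> \<open>The backtrack starts at the base point, and \<open>tl\<close> removes its
      first vertex; the last vertex of \<open>\<beta>\<close> takes its place.\<close>
    then have "t = x" using backtrack by (simp add: edge_loops_def edge_path_def)
    then have "\<beta> = butlast \<beta> @ [t]"
      using backtrack by (metis append_butlast_last_id edge_loops_def edge_path_def mem_Collect_eq)
    then obtain \<beta>' where "\<beta> = \<beta>' @ [t]" by blast
    then show ?thesis
      using loop loop_homotopic.backtrack[of \<beta>' t u \<delta>] Nil by simp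
  next
    case (Cons a \<alpha>')
    then show ?thesis
      using loop loop_homotopic.backtrack[of "\<beta> @ \<alpha>'" t u \<delta>] by simp
  qed
qed

section \<open>The group of homotopy classes of loops\<close>

lemma loop_class_eq: "loop_homotopic V E x \<gamma> \<gamma>' \<Longrightarrow> loop_class V E x \<gamma> = loop_class V E x \<gamma>'"
  unfolding loop_class_def by (blast intro: loop_homotopic.sym loop_homotopic.trans)

text \<open>The product is a union over all representatives. All members of this union are the same
  class, and both index sets are nonempty.\<close>

lemma loop_class_mult:
  assumes "\<gamma> \<in> edge_loops V E x" "\<gamma>' \<in> edge_loops V E x"
  shows "loop_class V E x \<gamma> \<otimes>\<^bsub>fundamental_group V E x\<^esub> loop_class V E x \<gamma>' =
    loop_class V E x (\<gamma> @ tl \<gamma>')"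
proof -
  have "loop_class V E x (\<alpha> @ tl \<beta>) = loop_class V E x (\<gamma> @ tl \<gamma>')"
    if "\<alpha> \<in> loop_class V E x \<gamma>" "\<beta> \<in> loop_class V E x \<gamma>'" for \<alpha> \<beta>
  proof -
    have "loop_homotopic V E x \<gamma> \<alpha>" "loop_homotopic V E x \<gamma>' \<beta>"
      using that by (simp_all add: loop_class_def)
    then have "loop_homotopic V E x (\<gamma> @ tl \<gamma>') (\<alpha> @ tl \<gamma>')"
        "loop_homotopic V E x (\<alpha> @ tl \<gamma>') (\<alpha> @ tl \<beta>)"
      using assms(2) loop_homotopic_loops[of V E x \<gamma> \<alpha>]
      by (simp_all add: loop_homotopic_append_left loop_homotopic_append_right)
    from this[THEN loop_class_eq] show ?thesis by simp
  qed
  then have "(\<Union>\<alpha>\<in>loop_class V E x \<gamma>. \<Union>\<beta>\<in>loop_class V E x \<gamma>'. loop_class V E x (\<alpha> @ tl \<beta>)) =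
      (\<Union>\<alpha>\<in>loop_class V E x \<gamma>. \<Union>\<beta>\<in>loop_class V E x \<gamma>'. loop_class V E x (\<gamma> @ tl \<gamma>'))"
    by (intro SUP_cong HOL.refl) blast
  moreover have "\<gamma> \<in> loop_class V E x \<gamma>" "\<gamma>' \<in> loop_class V E x \<gamma>'"
    using assms by (simp_all add: loop_class_def loop_homotopic.refl)
  then have "loop_class V E x \<gamma> \<noteq> {}" "loop_class V E x \<gamma>' \<noteq> {}" by blast+
  ultimately show ?thesis by (simp add: fundamental_group_def)
qed

text \<open>A free endpoint allows induction from the far end: the turn \<open>t, u, t\<close> in
  the middle of a path followed by its reverse is a single backtrack.\<close>

lemma path_rev_homotopic:
  assumes "symp_on V E" "edge_path V E x y \<gamma>"
  shows "loop_homotopic V E x (\<gamma> @ tl (rev \<gamma>)) [x]"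
  using assms(2)
proof (induction \<gamma> arbitrary: y rule: rev_induct)
  case Nil
  then show ?case by (simp add: edge_path_def)
next
  case (snoc u \<gamma>)
  show ?case
  proof (cases \<gamma> rule: rev_cases)
    case Nil
    then show ?thesis using snoc.prems
      by (auto simp: edge_path_def edge_loops_def intro!: loop_homotopic.refl)
  next
    case (snoc \<gamma>' t)
    have "edge_path V E x t \<gamma>"
      using snoc.prems snoc by (auto simp: edge_path_def successively_append_iff hd_append)
    then have IH: "loop_homotopic V E x (\<gamma> @ tl (rev \<gamma>)) [x]" using snoc.IH by blast
    have "(\<gamma> @ [u]) @ tl (rev (\<gamma> @ [u])) \<in> edge_loops V E x"
      using edge_path_append[OF snoc.prems edge_path_rev[OF assms(1) snoc.prems]]
      by (simp add: edge_loops_def)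
    then have "loop_homotopic V E x ((\<gamma> @ [u]) @ tl (rev (\<gamma> @ [u]))) (\<gamma> @ tl (rev \<gamma>))"
      using loop_homotopic.backtrack[of \<gamma>' t u "rev \<gamma>'" V E x] snoc by simp
    then show ?thesis using IH loop_homotopic.trans by metis
  qed
qed

lemma trivial_loop: "x \<in> V \<Longrightarrow> [x] \<in> edge_loops V E x"
  by (simp add: edge_loops_def edge_path_def)

lemma loop_class_inverse:
  assumes "symp_on V E" "\<gamma> \<in> edge_loops V E x"
  shows "loop_class V E x \<gamma> \<otimes>\<^bsub>fundamental_group V E x\<^esub> loop_class V E x (rev \<gamma>) =
      \<one>\<^bsub>fundamental_group V E x\<^esub>"
    and "loop_class V E x (rev \<gamma>) \<otimes>\<^bsub>fundamental_group V E x\<^esub> loop_class V E x \<gamma> =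
      \<one>\<^bsub>fundamental_group V E x\<^esub>"
proof -
  have g: "edge_path V E x x \<gamma>" "edge_path V E x x (rev \<gamma>)"
    using assms edge_path_rev by (auto simp: edge_loops_def)
  note h = path_rev_homotopic[OF assms(1) g(1), THEN loop_class_eq]
    path_rev_homotopic[OF assms(1) g(2), THEN loop_class_eq]
  show "loop_class V E x \<gamma> \<otimes>\<^bsub>fundamental_group V E x\<^esub> loop_class V E x (rev \<gamma>) =
      \<one>\<^bsub>fundamental_group V E x\<^esub>"
    "loop_class V E x (rev \<gamma>) \<otimes>\<^bsub>fundamental_group V E x\<^esub> loop_class V E x \<gamma> =
      \<one>\<^bsub>fundamental_group V E x\<^esub>"
    using g h by (simp_all add: loop_class_mult edge_loops_def) (simp_all add: fundamental_group_def)
qed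

lemma group_fundamental_group:
  assumes "symp_on V E" "x \<in> V"
  shows "group (fundamental_group V E x)"
proof -
  let ?G = "fundamental_group V E x"
  have carrier: "carrier ?G = loop_class V E x ` edge_loops V E x"
    and one: "\<one>\<^bsub>?G\<^esub> = loop_class V E x [x]" by (simp_all add: fundamental_group_def)
  have loop: "\<gamma> \<noteq> [] \<and> hd \<gamma> = x" if "\<gamma> \<in> edge_loops V E x" for \<gamma>
    using that by (simp add: edge_loops_def edge_path_def)
  show ?thesis
  proof (rule groupI)
    fix A B C assume "A \<in> carrier ?G" "B \<in> carrier ?G" "C \<in> carrier ?G"
    then obtain \<alpha> \<beta> \<gamma> where
      "\<alpha> \<in> edge_loops V E x" "\<beta> \<in> edge_loops V E x" "\<gamma> \<in> edge_loops V E x"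
      "A = loop_class V E x \<alpha>" "B = loop_class V E x \<beta>" "C = loop_class V E x \<gamma>"
      by (auto simp: carrier)
    then show "A \<otimes>\<^bsub>?G\<^esub> B \<otimes>\<^bsub>?G\<^esub> C = A \<otimes>\<^bsub>?G\<^esub> (B \<otimes>\<^bsub>?G\<^esub> C)"
      by (simp add: loop_class_mult append_loop loop tl_append_if)
  next
    fix A assume "A \<in> carrier ?G"
    then obtain \<alpha> where \<alpha>: "\<alpha> \<in> edge_loops V E x" "A = loop_class V E x \<alpha>"
      by (auto simp: carrier)
    then have "[x] @ tl \<alpha> = \<alpha>" using loop[OF \<alpha>(1)] by (cases \<alpha>) auto
    then show "\<one>\<^bsub>?G\<^esub> \<otimes>\<^bsub>?G\<^esub> A = A"
      using \<alpha> loop_class_mult[OF trivial_loop[OF assms(2)] \<alpha>(1)] by (simp add: one)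
    have "rev \<alpha> \<in> edge_loops V E x"
      using \<alpha>(1) edge_path_rev[OF assms(1)] by (auto simp: edge_loops_def)
    then show "\<exists>B\<in>carrier ?G. B \<otimes>\<^bsub>?G\<^esub> A = \<one>\<^bsub>?G\<^esub>"
      using loop_class_inverse(2)[OF assms(1) \<alpha>(1)] \<alpha>(2) by (auto simp: carrier)
  qed (auto simp: carrier one loop_class_mult append_loop intro!: imageI trivial_loop assms(2))
qed

lemma rev_loop:
  "symp_on V E \<Longrightarrow> \<gamma> \<in> edge_loops V E x \<Longrightarrow> rev \<gamma> \<in> edge_loops V E x"
  by (simp add: edge_loops_def edge_path_rev)

text \<open>\<open>generate\<close> also adjoins inverses of generators, which are thereby
  recognised as classes of loops.\<close>

lemma inv_loop_class:
  assumes "symp_on V E" "x \<in> V" "\<gamma> \<in> edge_loops V E x"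
  shows "inv\<^bsub>fundamental_group V E x\<^esub> (loop_class V E x \<gamma>) = loop_class V E x (rev \<gamma>)"
proof (rule group.inv_equality)
  show "group (fundamental_group V E x)" using assms(1,2) by (rule group_fundamental_group)
  show "loop_class V E x (rev \<gamma>) \<otimes>\<^bsub>fundamental_group V E x\<^esub> loop_class V E x \<gamma> =
      \<one>\<^bsub>fundamental_group V E x\<^esub>"
    using assms(1,3) by (rule loop_class_inverse)
qed (use assms rev_loop[OF assms(1,3)] in \<open>simp_all add: fundamental_group_def\<close>)

context coxeter begin

section \<open>Path elements\<close>

abbreviation "E \<equiv> oddly_joined W"

section \<open>Multiplicativity and homotopy invariance of path elements\<close>

lemma path_element_closed [simp]: "set \<gamma> \<subseteq> S \<Longrightarrow> path_element W \<gamma> \<in> carrier W"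
  by (induction \<gamma> rule: induct_list012) (auto simp: S_carrier)

lemma path_element_edge:
  assumes "t \<in> S" "u \<in> S"
  shows "path_element W [t, u] = rot t u (- int (ord (t \<otimes> u) div 2))"
proof -
  have "rot t u (- int n) = (u \<otimes> t) [^] n" for n
    using assms by (simp add: rot_def int_pow_neg int_pow_int S_simps inv_mult_group flip: nat_pow_inv)
  then show ?thesis using assms by (simp add: S_carrier)
qed

lemma path_element_edge_rev:
  assumes "t \<in> S" "u \<in> S"
  shows "path_element W [u, t] = inv (path_element W [t, u])"
proof -
  have "path_element W [u, t] = rot t u (int (ord (t \<otimes> u) div 2))"
    using assms ord_commute[OF assms] by (simp add: rot_def int_pow_int S_carrier)
  then show ?thesis
    using path_element_edge[OF assms] rot_inv[OF assms, of "- int (ord (t \<otimes> u) div 2)"] by simp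
qed

lemma path_element_append:
  "set (\<alpha> @ t # \<beta>) \<subseteq> S \<Longrightarrow>
    path_element W (\<alpha> @ t # \<beta>) = path_element W (\<alpha> @ [t]) \<otimes> path_element W (t # \<beta>)"
proof (induction \<alpha> rule: induct_list012)
  case (3 x y \<alpha>)
  then show ?case by (simp add: S_carrier m_assoc)
qed (auto simp: S_carrier m_assoc)

lemma path_element_rev: "set \<gamma> \<subseteq> S \<Longrightarrow> path_element W (rev \<gamma>) = inv (path_element W \<gamma>)"
proof (induction \<gamma> rule: induct_list012)
  case (3 t u \<gamma>)
  have "path_element W (rev (t # u # \<gamma>)) = path_element W (rev (u # \<gamma>)) \<otimes> path_element W [u, t]"
    using 3(3) path_element_append[of "rev \<gamma>" u "[t]"] by simp
  moreover have "path_element W (t # u # \<gamma>) = path_element W [t, u] \<otimes> path_element W (u # \<gamma>)"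
    using 3(3) path_element_append[of "[t]" u \<gamma>] by simp
  moreover have "path_element W [t, u] \<in> carrier W" "path_element W (u # \<gamma>) \<in> carrier W"
    using 3(3) by (simp_all del: path_element.simps)
  moreover have "path_element W (rev (u # \<gamma>)) = inv (path_element W (u # \<gamma>))"
    using 3(2,3) by simp
  ultimately show ?case
    using 3(3) path_element_edge_rev[of t u] by (simp add: inv_mult_group del: path_element.simps)
qed auto

lemma path_element_join:
  assumes "edge_path S E x y \<gamma>" "edge_path S E y z \<gamma>'"
  shows "path_element W (\<gamma> @ tl \<gamma>') = path_element W \<gamma> \<otimes> path_element W \<gamma>'"
proof -
  have g: "\<gamma> \<noteq> []" "last \<gamma> = y" "set \<gamma> \<subseteq> S" and g': "\<gamma>' \<noteq> []" "hd \<gamma>' = y" "set \<gamma>' \<subseteq> S"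
    using assms by (auto simp: edge_path_def)
  have 1: "\<gamma> = butlast \<gamma> @ [y]" using g by (metis append_butlast_last_id)
  have 2: "\<gamma>' = y # tl \<gamma>'" using g' by (cases \<gamma>') auto
  have eq: "\<gamma> @ tl \<gamma>' = butlast \<gamma> @ y # tl \<gamma>'" by (subst 1) simp
  have "set (butlast \<gamma> @ y # tl \<gamma>') \<subseteq> S"
    using g(3) g'(3) unfolding eq[symmetric] by (auto dest: list.set_sel(2)[OF g'(1)])
  from path_element_append[OF this] show ?thesis unfolding eq 1[symmetric] 2[symmetric] .
qed

text \<open>An edge traversed forth and back contributes an element and its inverse.\<close>

lemma path_element_backtrack:
  assumes "set (\<alpha> @ [t, u, t] @ \<beta>) \<subseteq> S"
  shows "path_element W (\<alpha> @ [t, u, t] @ \<beta>) = path_element W (\<alpha> @ [t] @ \<beta>)"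
proof -
  have tu: "t \<in> S" "u \<in> S" using assms by auto
  have sub: "set (\<alpha> @ [t]) \<subseteq> S" "set (t # \<beta>) \<subseteq> S" "set [t, u] \<subseteq> S" using assms by auto
  have "path_element W (t # u # t # \<beta>) =
      path_element W [t, u] \<otimes> (path_element W [u, t] \<otimes> path_element W (t # \<beta>))"
    using path_element_append[of "[t]" u "t # \<beta>"] path_element_append[of "[u]" t \<beta>] assms
    by (simp del: path_element.simps)
  also have "\<dots> = path_element W (t # \<beta>)"
    unfolding path_element_edge_rev[OF tu]
    using path_element_closed[OF sub(2)] path_element_closed[OF sub(3)]
    by (simp del: path_element.simps path_element_closed)
  finally show ?thesis
    using path_element_append[of \<alpha> t "u # t # \<beta>"] path_element_append[of \<alpha> t \<beta>] assms
    by (simp del: path_element.simps)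
qed

lemma path_element_homotopic:
  "loop_homotopic S E x \<gamma> \<gamma>' \<Longrightarrow> path_element W \<gamma> = path_element W \<gamma>'"
proof (induction rule: loop_homotopic.induct)
  case (backtrack \<alpha> t u \<beta>)
  then show ?case by (intro path_element_backtrack) (simp add: edge_loops_def edge_path_def)
qed auto

lemma symp_on_odd: "symp_on S E"
  by (rule symp_onI) (auto simp: oddly_joined_def ord_commute)

text \<open>Each edge factor carries the end of its edge to the start, so the product carries the
  last vertex to the first.\<close>

lemma conjugate_path_element:
  assumes "edge_path S E x y \<gamma>"
  shows "conjugate (path_element W \<gamma>) y = x"
  using assms
proof (induction \<gamma> arbitrary: x rule: induct_list012)
  case (3 t u \<gamma>)
  then have p: "edge_path S E u y (u # \<gamma>)" and tu: "t \<in> S" "u \<in> S" "E t u" "x = t"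
    by (auto simp: edge_path_def)
  have uc: "u \<in> carrier W" "path_element W (u # \<gamma>) \<in> carrier W" "y \<in> carrier W"
    using p tu last_in_set[of "u # \<gamma>"] by (auto simp: edge_path_def intro!: S_carrier)
  define m where "m = ord (t \<otimes> u)"
  have "odd m" using tu by (simp add: oddly_joined_def m_def)
  then have m: "2 * int (m div 2) = int m - 1" by presburger
  have "path_element W (t # u # \<gamma>) = rot t u (- int (m div 2)) \<otimes> path_element W (u # \<gamma>)"
    using path_element_append[of "[t]" u \<gamma>] path_element_edge[OF tu(1,2)] 3(3) tu(1)
    by (simp add: m_def edge_path_def del: path_element.simps)
  then have "conjugate (path_element W (t # u # \<gamma>)) y = conjugate (rot t u (- int (m div 2))) u"
    using 3(2)[OF p] uc tu by (simp add: conjugate_mult del: path_element.simps)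
  \<comment> \<open>The index 0 of \<open>u\<close> is shifted by
    \<open>2 * (m div 2) = m - 1\<close>, which is congruent modulo \<open>m\<close> to the index
    \<open>- 1\<close> of \<open>t\<close>.\<close>
  also have "\<dots> = u \<otimes> rot t u (int m - 1)"
    using conjugate_rot_reflection[OF tu(1,2), of "- int (m div 2)" 0] uc m tu by simp
  also have "\<dots> = t"
    using u_rot_eq_iff[OF tu(1,2), of "int m - 1" "- 1"] by (simp add: m_def flip: t_rot[OF tu(1,2)])
  finally show ?case using tu by simp
qed (auto simp: edge_path_def S_carrier)

text \<open>\<open>path_element\<close> is multiplicative on loops and constant on homotopy classes,
  so it factors through the fundamental group. In place of the induced homomorphism, an induction
  over \<open>generate\<close> shows that all loops in a generated class have their path elements in
  the subgroup.\<close>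

lemma Gamma_Omega_generators:
  assumes sS: "s \<in> S" and Z: "Z \<subseteq> edge_loops S E s"
    and gen: "generate (fundamental_group S E s) (loop_class S E s ` Z) =
      carrier (fundamental_group S E s)"
  shows "generate W (path_element W ` Z) = Gamma_Omega W S s"
proof
  have loops_carrier: "path_element W ` edge_loops S E s \<subseteq> carrier W"
    by (auto simp: edge_loops_def edge_path_def)
  then show "generate W (path_element W ` Z) \<subseteq> Gamma_Omega W S s"
    unfolding Gamma_Omega_def using Z by (intro mono_generate image_mono)
  have sub: "subgroup (generate W (path_element W ` Z)) W"
    using Z loops_carrier by (intro generate_is_subgroup) blast
  have key: "\<forall>\<gamma> \<in> C. \<gamma> \<in> edge_loops S E s \<and> path_element W \<gamma> \<in> generate W (path_element W ` Z)"
    if "C \<in> generate (fundamental_group S E s) (loop_class S E s ` Z)" for C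
  proof -
    have in_class: "\<forall>\<gamma> \<in> loop_class S E s \<gamma>0. \<gamma> \<in> edge_loops S E s \<and>
        path_element W \<gamma> \<in> generate W (path_element W ` Z)"
      if "path_element W \<gamma>0 \<in> generate W (path_element W ` Z)" for \<gamma>0
    proof
      fix \<gamma> assume "\<gamma> \<in> loop_class S E s \<gamma>0"
      then have "loop_homotopic S E s \<gamma>0 \<gamma>" by (simp add: loop_class_def)
      then show "\<gamma> \<in> edge_loops S E s \<and> path_element W \<gamma> \<in> generate W (path_element W ` Z)"
        using that path_element_homotopic loop_homotopic_loops by metis
    qed
    from that show ?thesis
    proof induction
      case one
      then show ?case using in_class[of "[s]"] sub
        by (simp add: fundamental_group_def subgroup.one_closed)
    next
      case (incl C)
      then obtain \<gamma>0 where g: "\<gamma>0 \<in> Z" "C = loop_class S E s \<gamma>0" by blast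
      have "path_element W \<gamma>0 \<in> generate W (path_element W ` Z)"
        using g(1) by (intro generate.incl imageI)
      then show ?case unfolding g(2) by (rule in_class)
    next
      case (inv C)
      then obtain \<gamma>0 where g: "\<gamma>0 \<in> Z" "C = loop_class S E s \<gamma>0" by blast
      have g0: "\<gamma>0 \<in> edge_loops S E s" using Z g(1) by blast
      then have "path_element W (rev \<gamma>0) = inv (path_element W \<gamma>0)"
        by (intro path_element_rev) (simp add: edge_loops_def edge_path_def)
      then have "path_element W (rev \<gamma>0) \<in> generate W (path_element W ` Z)"
        using g(1) by (simp add: generate.inv)
      then show ?case unfolding g(2) inv_loop_class[OF symp_on_odd sS g0] by (rule in_class)
    next
      case (eng A B)
      show ?case
      proof
        fix \<gamma> assume "\<gamma> \<in> A \<otimes>\<^bsub>fundamental_group S E s\<^esub> B"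
        then obtain \<alpha> \<beta> where ab: "\<alpha> \<in> A" "\<beta> \<in> B" "\<gamma> \<in> loop_class S E s (\<alpha> @ tl \<beta>)"
          by (auto simp: fundamental_group_def)
        have "edge_path S E s s \<alpha>" "edge_path S E s s \<beta>"
          "path_element W \<alpha> \<in> generate W (path_element W ` Z)"
          "path_element W \<beta> \<in> generate W (path_element W ` Z)"
          using eng.IH ab(1,2) by (simp_all add: edge_loops_def)
        then have "path_element W (\<alpha> @ tl \<beta>) \<in> generate W (path_element W ` Z)"
          by (simp add: path_element_join generate.eng)
        then show "\<gamma> \<in> edge_loops S E s \<and> path_element W \<gamma> \<in> generate W (path_element W ` Z)"
          using in_class ab(3) by blast
      qed
    qed
  qed
  have "path_element W \<gamma> \<in> generate W (path_element W ` Z)" if "\<gamma> \<in> edge_loops S E s" for \<gamma>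
  proof -
    have "loop_class S E s \<gamma> \<in> generate (fundamental_group S E s) (loop_class S E s ` Z)"
      unfolding gen using that by (simp add: fundamental_group_def)
    moreover have "\<gamma> \<in> loop_class S E s \<gamma>"
      using that by (simp add: loop_class_def loop_homotopic.refl)
    ultimately show ?thesis using key by blast
  qed
  then show "Gamma_Omega W S s \<subseteq> generate W (path_element W ` Z)"
    unfolding Gamma_Omega_def by (intro generate_subgroup_incl[OF _ sub]) blast
qed

section \<open>Generators of the centralizer\<close>

text \<open>Rotations shift the index by two, so an even index leads to \<open>u\<close> and an odd
  one to \<open>t\<close>.\<close>

lemma dihedral_reflection_conjugate:
  assumes tu: "t \<in> S" "u \<in> S"
  shows "\<exists>g \<in> carrier W. \<exists>v \<in> S. u \<otimes> rot t u j = conjugate g v"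
proof (cases "even j")
  case True
  then obtain i where "j = 2 * i" by blast
  then have "u \<otimes> rot t u j = conjugate (rot t u (- i)) u"
    using conjugate_rot_reflection[OF tu, of "- i" 0] tu by (simp add: S_carrier)
  then show ?thesis using tu by (meson rot_closed)
next
  case False
  then obtain i where "j = 2 * i + 1" by (elim oddE)
  then have "u \<otimes> rot t u j = conjugate (rot t u (- i - 1)) t"
    using conjugate_rot_reflection[OF tu, of "- i - 1" "- 1"]
    by (simp add: add.commute flip: t_rot[OF tu])
  then show ?thesis using tu by (meson rot_closed)
qed

text \<open>With \<open>m = 2 * k\<close> the order of \<open>t \<otimes> u\<close>, the local
  factor \<open>x\<close> is \<open>t\<close> times the half turn \<open>rot t u k\<close>. It is a
  reflection of the dihedral subgroup that commutes with \<open>t\<close> and differs from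
  \<open>t\<close>. The path element carries \<open>t\<close> to \<open>s\<close>, and these
  properties with it.\<close>

lemma path_reflection_properties:
  assumes p: "edge_path S E s t \<gamma>" and u: "u \<in> S" "evenly_joined W t u"
  shows "path_reflection W \<gamma> u \<in> reflections W S \<inter> centralizer W s - {s}"
proof -
  have last: "last \<gamma> = t" and sub: "set \<gamma> \<subseteq> S" and "t \<in> S"
    using p by (auto simp: edge_path_def)
  note tu = \<open>t \<in> S\<close> u(1)
  have tc: "t \<in> carrier W" "u \<in> carrier W" using tu by (simp_all add: S_carrier)
  define m where "m = ord (t \<otimes> u)"
  obtain k where k: "m = 2 * k" "k \<noteq> 0" using u(2) by (auto simp: evenly_joined_def m_def elim!: evenE)
  define x where "x = u \<otimes> rot t u (int (k - 1))"
  define g where "g = path_element W \<gamma>"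
  have gc: "g \<in> carrier W" using sub by (simp add: g_def)
  have xc: "x \<in> carrier W" using tc tu by (simp add: x_def)
  have "(u \<otimes> t) [^] (k - 1) = rot t u (- int (k - 1))"
    using tu by (simp add: rot_def int_pow_neg int_pow_int S_simps inv_mult_group del: of_nat_diff flip: nat_pow_inv)
  then have "(u \<otimes> t) [^] (k - 1) \<otimes> u = x"
    using rot_u[OF tu, of "- int (k - 1)"] by (simp add: x_def)
  then have r: "path_reflection W \<gamma> u = conjugate g x"
    using k ord_commute[OF tu] by (simp add: path_reflection_def conjugate_def last g_def flip: m_def)
  obtain h v where hv: "h \<in> carrier W" "v \<in> S" "x = conjugate h v"
    using dihedral_reflection_conjugate[OF tu, of "int (k - 1)"] by (auto simp: x_def)
  have "conjugate g x = conjugate (g \<otimes> h) v" using hv gc by (simp add: conjugate_mult S_carrier)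
  then have refl: "conjugate g x \<in> reflections W S"
    using hv gc m_closed[OF gc hv(1)] unfolding reflections_def conjugate_def[of "g \<otimes> h"] by blast
  have "conjugate x t = conjugate u (conjugate (rot t u (int (k - 1))) t)"
    using tc tu by (simp add: x_def conjugate_mult)
  also have "conjugate (rot t u (int (k - 1))) t = u \<otimes> rot t u (- 1 - 2 * int (k - 1))"
    using conjugate_rot_reflection[OF tu, of "int (k - 1)" "- 1"] by (simp flip: t_rot[OF tu])
  also have "conjugate u \<dots> = u \<otimes> rot t u (1 + 2 * int (k - 1))"
    using conjugate_u_reflection[OF tu, of "- 1 - 2 * int (k - 1)"] by (simp add: add.commute)
  also have "1 + 2 * int (k - 1) = int m - 1" using k by simp
  also have "u \<otimes> rot t u (int m - 1) = t"
    using u_rot_eq_iff[OF tu, of "int m - 1" "- 1"] by (simp add: m_def flip: t_rot[OF tu])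
  finally have xt: "x \<otimes> t = t \<otimes> x" using conjugate_commute[OF xc tc(1) tc(1)] by simp
  have s: "s = conjugate g t" using conjugate_path_element[OF p] by (simp add: g_def)
  have "conjugate g x \<otimes> s = s \<otimes> conjugate g x"
  proof -
    have "conjugate g a \<otimes> conjugate g b = conjugate g (a \<otimes> b)"
      if "a \<in> carrier W" "b \<in> carrier W" for a b
      using that gc by (simp add: conjugate_def m_assoc)
    then show ?thesis using xt xc tc by (simp add: s)
  qed
  then have cent: "conjugate g x \<in> centralizer W s" using gc xc by (simp add: centralizer_def)
  \<comment> \<open>The indices \<open>k - 1\<close> and \<open>- 1\<close> differ by
    \<open>k\<close>, which is no multiple of \<open>m = 2 * k\<close>.\<close>
  have "x \<noteq> t"
  proof
    assume "x = t"
    then have "int m dvd int (k - 1) - (- 1)"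
      using u_rot_eq_iff[OF tu, of "int (k - 1)" "- 1"] by (simp add: x_def m_def flip: t_rot[OF tu])
    also have "int (k - 1) - (- 1) = int k" using k(2) by simp
    finally have "m dvd k" by simp
    then show False using k by (auto dest: dvd_imp_le)
  qed
  then have "conjugate g x \<noteq> s" using gc xc tc unfolding s by (metis conjugate_inv(1))
  then show ?thesis using refl cent unfolding r by blast
qed

lemma centralizer_conjugate:
  assumes "s \<in> carrier W"
  shows "g \<in> centralizer W s \<longleftrightarrow> g \<in> carrier W \<and> conjugate g s = s"
  using assms conjugate_commute by (auto simp: centralizer_def)

text \<open>This makes \<open>positive_centralizer_subset\<close> applicable to the generators of
  \<open>W_Omega\<close>.\<close>

lemma reflection_not_eta:
  assumes "s \<in> S" "g \<in> reflections W S \<inter> centralizer W s - {s}"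
  shows "g \<in> carrier W \<and> conjugate g s = s \<and> \<not> eta g s"
proof -
  have sc: "s \<in> carrier W" using assms by (simp add: S_carrier)
  obtain h v where "h \<in> carrier W" "v \<in> S" "g = conjugate h v"
    using assms(2) by (auto simp: reflections_def conjugate_def)
  then show ?thesis
    using assms(2) sc centralizer_conjugate[OF sc, of g] eta_reflection_commuting[of h v s] by auto
qed

section \<open>Schreier generators from a choice of paths in the component\<close>

context
  fixes s V
  assumes sS: "s \<in> S"
  defines "V \<equiv> component S E s"
begin

lemma component_subset: "V \<subseteq> S"
  by (auto simp: V_def component_def edge_path_def)

lemma base_in_component: "s \<in> V"
  using sS by (auto simp: V_def component_def edge_path_def intro!: exI[of _ "[s]"])

lemma component_step:
  assumes "u \<in> V" "t \<in> S" "E u t"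
  shows "t \<in> V"
proof -
  obtain \<gamma> where "edge_path S E s u \<gamma>" using assms by (auto simp: V_def component_def)
  then have "edge_path S E s t (\<gamma> @ tl [u, t])"
    using assms component_subset by (intro edge_path_append) (auto simp: edge_path_def)
  then show ?thesis by (auto simp: V_def component_def)
qed

lemma edge_path_component: "edge_path V E x y \<gamma> \<Longrightarrow> edge_path S E x y \<gamma>"
  using component_subset by (auto simp: edge_path_def)

context
  fixes \<delta> :: "'a \<Rightarrow> 'a list"
  assumes \<delta>: "\<And>t. t \<in> V \<Longrightarrow> edge_path S E s t (\<delta> t)"
begin

text \<open>The Schreier loop of the edge from \<open>u\<close> to \<open>t\<close>: out along
  \<open>\<delta> u\<close>, across the edge, back along \<open>\<delta> t\<close>. The reversed
  path loses its first vertex, which the edge already supplies.\<close>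

definition tree_loop where "tree_loop u t = \<delta> u @ t # tl (rev (\<delta> t))"

lemma tree_loop:
  assumes "u \<in> V" "t \<in> S" "E u t"
  shows "tree_loop u t \<in> edge_loops S E s"
    and "path_element W (tree_loop u t) =
      path_element W (\<delta> u) \<otimes> path_element W [u, t] \<otimes> inv (path_element W (\<delta> t))"
proof -
  have tV: "t \<in> V" by (rule component_step[OF assms])
  have p: "edge_path S E u t [u, t]"
    using assms component_subset by (auto simp: edge_path_def)
  note q = edge_path_rev[OF symp_on_odd \<delta>[OF tV]]
  have pq: "edge_path S E s t (\<delta> u @ tl [u, t])"
    using edge_path_append[OF \<delta>[OF assms(1)] p] .
  have eq: "tree_loop u t = (\<delta> u @ tl [u, t]) @ tl (rev (\<delta> t))"
    by (simp add: tree_loop_def)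
  show "tree_loop u t \<in> edge_loops S E s"
    using edge_path_append[OF pq q] by (simp add: eq edge_loops_def)
  have "set (\<delta> t) \<subseteq> S" using \<delta>[OF tV] by (simp add: edge_path_def)
  from path_element_rev[OF this] show "path_element W (tree_loop u t) =
      path_element W (\<delta> u) \<otimes> path_element W [u, t] \<otimes> inv (path_element W (\<delta> t))"
    unfolding eq path_element_join[OF pq q] path_element_join[OF \<delta>[OF assms(1)] p] by simp
qed

text \<open>Take \<open>q t\<close> to be the path element of \<open>\<delta> t\<close> in
  \<open>transporter_in_coset\<close>: Schreier loops give the odd steps and path reflections the
  even ones. At \<open>t = s\<close> the factor \<open>q s\<close> is removed by
  \<open>base\<close>.\<close>

lemma positive_centralizer_subset:
  assumes H: "subgroup H W" and base: "path_element W (\<delta> s) \<in> H"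
    and loops: "\<And>t u. u \<in> V \<Longrightarrow> t \<in> V \<Longrightarrow> E u t \<Longrightarrow> path_element W (tree_loop u t) \<in> H"
    and refl: "\<And>t u. t \<in> V \<Longrightarrow> u \<in> S \<Longrightarrow> evenly_joined W t u \<Longrightarrow> path_reflection W (\<delta> t) u \<in> H"
    and g: "g \<in> carrier W" "conjugate g s = s" "\<not> eta g s"
  shows "g \<in> H"
proof -
  let ?q = "\<lambda>t. path_element W (\<delta> t)"
  have q: "?q t \<in> carrier W" if "t \<in> V" for t
    using \<delta>[OF that] by (simp add: edge_path_def)
  have "s \<in> V \<and> g \<otimes> inv (?q s) \<in> H"
  proof (rule transporter_in_coset[where q = ?q, OF sS H base_in_component base])
    show "t \<in> V \<and> ?q u \<otimes> path_element W [u, t] \<otimes> inv (?q t) \<in> H"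
      if "u \<in> V" "t \<in> S" "E u t" for t u
      using loops[of u t] component_step[OF that] tree_loop(2)[OF that] that by simp
    show "?q t \<otimes> ((u \<otimes> t) [^] (ord (u \<otimes> t) div 2 - 1) \<otimes> u) \<otimes> inv (?q t) \<in> H"
      if "t \<in> V" "u \<in> S" "evenly_joined W t u" for t u
      using refl[OF that] \<delta>[OF that(1)] by (simp add: path_reflection_def edge_path_def)
  qed (use q sS g in simp_all)
  then have "g \<otimes> inv (?q s) \<otimes> ?q s \<in> H" using subgroup.m_closed[OF H] base by blast
  then show ?thesis using g q[OF base_in_component] by (simp add: m_assoc)
qed

lemma W_Gamma_Omega_generators:
  assumes Z: "Z \<subseteq> edge_loops S E s" "generate W (path_element W ` Z) = Gamma_Omega W S s"
  shows "generate W (path_element W ` Z \<union>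
      {path_reflection W (\<delta> t) u | t u. t \<in> V \<and> u \<in> S \<and> evenly_joined W t u}) =
    W_Gamma_Omega W S s"
    (is "generate W (?P \<union> ?R) = _")
proof
  have R: "?R \<subseteq> reflections W S \<inter> centralizer W s - {s}"
    using path_reflection_properties \<delta> by blast
  have P: "path_element W ` edge_loops S E s \<subseteq> carrier W"
    by (auto simp: edge_loops_def edge_path_def)
  have cent: "reflections W S \<inter> centralizer W s - {s} \<subseteq> carrier W"
    by (auto simp: centralizer_def)
  have sub: "subgroup (generate W (?P \<union> ?R)) W"
    using Z(1) P R cent by (intro generate_is_subgroup) blast
  have WG: "W_Omega W S s \<union> Gamma_Omega W S s \<subseteq> carrier W"
    unfolding W_Omega_def Gamma_Omega_def using generate_incl[OF P] generate_incl[OF cent] by blast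
  have "?P \<subseteq> Gamma_Omega W S s" unfolding Z(2)[symmetric] by (blast intro: generate.incl)
  moreover have "?R \<subseteq> W_Omega W S s" unfolding W_Omega_def using R by (blast intro: generate.incl)
  ultimately show "generate W (?P \<union> ?R) \<subseteq> W_Gamma_Omega W S s"
    unfolding W_Gamma_Omega_def by (intro mono_generate) blast
  have Gamma: "Gamma_Omega W S s \<subseteq> generate W (?P \<union> ?R)"
    unfolding Z(2)[symmetric] by (intro mono_generate) blast
  \<comment> \<open>\<open>Z\<close> enters only through \<open>Gamma_Omega\<close>; this covers
    \<open>\<delta> s\<close> and all Schreier loops.\<close>
  have loops: "path_element W \<gamma> \<in> generate W (?P \<union> ?R)" if "\<gamma> \<in> edge_loops S E s" for \<gamma>
    using that Gamma unfolding Gamma_Omega_def by (blast intro: generate.incl)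
  have "g \<in> generate W (?P \<union> ?R)" if g: "g \<in> reflections W S \<inter> centralizer W s - {s}" for g
  proof (rule positive_centralizer_subset[OF sub])
    show "path_element W (\<delta> s) \<in> generate W (?P \<union> ?R)"
      using \<delta>[OF base_in_component] by (intro loops) (simp add: edge_loops_def)
    show "path_element W (tree_loop u t) \<in> generate W (?P \<union> ?R)"
      if "u \<in> V" "t \<in> V" "E u t" for t u
      using that component_subset by (intro loops tree_loop(1)) auto
    show "path_reflection W (\<delta> t) u \<in> generate W (?P \<union> ?R)"
      if "t \<in> V" "u \<in> S" "evenly_joined W t u" for t u
      using that by (intro generate.incl) blast
  qed (use reflection_not_eta[OF sS g] in simp_all)
  then have "W_Omega W S s \<subseteq> generate W (?P \<union> ?R)"
    unfolding W_Omega_def by (intro generate_subgroup_incl[OF _ sub]) blast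
  then show "W_Gamma_Omega W S s \<subseteq> generate W (?P \<union> ?R)"
    unfolding W_Gamma_Omega_def using Gamma by (intro generate_subgroup_incl[OF _ sub]) blast
qed

end

section \<open>Finite generation of the centralizer\<close>

lemma centralizer_subgroup: "subgroup (centralizer W s) W"
proof -
  have sc: "s \<in> carrier W" using sS by (simp add: S_carrier)
  show ?thesis
  proof (rule subgroupI)
    show "centralizer W s \<noteq> {}" using sc by (auto simp: centralizer_def)
    show "inv g \<in> centralizer W s" if "g \<in> centralizer W s" for g
      using that sc conjugate_inv(1)[of g s] by (simp add: centralizer_conjugate)
    show "g \<otimes> h \<in> centralizer W s" if "g \<in> centralizer W s" "h \<in> centralizer W s" for g h
      using that sc by (simp add: centralizer_conjugate conjugate_mult)
  qed (auto simp: centralizer_def)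
qed

text \<open>For finite \<open>S\<close> there are finitely many Schreier loops and path reflections.
  Together with \<open>\<delta> s\<close> they yield the sign-preserving elements, and
  \<open>s\<close> accounts for the others.\<close>

lemma finitely_generated_centralizer:
  assumes "finite S"
  shows "finitely_generated (W\<lparr>carrier := centralizer W s\<rparr>)"
proof -
  have sc: "s \<in> carrier W" using sS by (simp add: S_carrier)
  have "\<forall>t \<in> V. \<exists>\<gamma>. edge_path S E s t \<gamma>" by (auto simp: V_def component_def)
  then obtain \<delta> where \<delta>: "\<And>t. t \<in> V \<Longrightarrow> edge_path S E s t (\<delta> t)" by metis
  define L where "L = insert (\<delta> s) ((\<lambda>(u, t). tree_loop \<delta> u t) ` {(u, t) \<in> V \<times> V. E u t})"
  define R where
    "R = (\<lambda>(t, u). path_reflection W (\<delta> t) u) ` {(t, u) \<in> V \<times> S. evenly_joined W t u}"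
  define A where "A = insert s (path_element W ` L \<union> R)"
  have "finite V" using component_subset assms by (rule finite_subset)
  then have "finite {(u, t) \<in> V \<times> V. E u t}" "finite {(t, u) \<in> V \<times> S. evenly_joined W t u}"
    using assms by (auto intro: finite_subset[of _ "V \<times> V"] finite_subset[of _ "V \<times> S"])
  then have fin: "finite A" by (simp add: A_def L_def R_def)
  have "L \<subseteq> edge_loops S E s"
    using tree_loop(1)[OF \<delta>] component_subset \<delta>[OF base_in_component]
    by (auto simp: L_def edge_loops_def)
  moreover have "path_element W \<gamma> \<in> centralizer W s" if "\<gamma> \<in> edge_loops S E s" for \<gamma>
    using that conjugate_path_element[of s s \<gamma>] centralizer_conjugate[OF sc]
    by (simp add: edge_loops_def) (simp add: edge_path_def)
  ultimately have "path_element W ` L \<subseteq> centralizer W s" by blast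
  moreover have "R \<subseteq> centralizer W s"
    using path_reflection_properties[OF \<delta>] by (auto simp: R_def)
  moreover have "s \<in> centralizer W s" using sc by (simp add: centralizer_def)
  ultimately have A: "A \<subseteq> centralizer W s" by (simp add: A_def)
  have "A \<subseteq> carrier W" using A by (auto simp: centralizer_def)
  then have sub: "subgroup (generate W A) W" by (rule generate_is_subgroup)
  have pos: "g \<in> generate W A" if "g \<in> carrier W" "conjugate g s = s" "\<not> eta g s" for g
  proof (rule positive_centralizer_subset[OF \<delta> sub _ _ _ that])
    show "path_element W (\<delta> s) \<in> generate W A"
      by (intro generate.incl) (simp add: A_def L_def)
    show "path_element W (tree_loop \<delta> u t) \<in> generate W A" if "u \<in> V" "t \<in> V" "E u t" for t u
      using that by (intro generate.incl) (auto simp: A_def L_def)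
    show "path_reflection W (\<delta> t) u \<in> generate W A"
      if "t \<in> V" "u \<in> S" "evenly_joined W t u" for t u
      using that by (intro generate.incl) (auto simp: A_def R_def)
  qed
  have "g \<in> generate W A" if "g \<in> centralizer W s" for g
  proof (cases "eta g s")
    case True
    have g: "g \<in> carrier W" "conjugate g s = s" using that sc by (simp_all add: centralizer_conjugate)
    \<comment> \<open>Multiplication by \<open>s\<close> reverses the sign at \<open>s\<close> and
      so reduces to the sign-preserving case.\<close>
    then have "\<not> eta (g \<otimes> s) s"
      using True sc sS eta_mult[of g s s] by (simp add: eta_generator)
    then have "g \<otimes> s \<in> generate W A" using g sc by (intro pos) (simp_all add: conjugate_mult)
    moreover have "s \<in> generate W A" by (intro generate.incl) (simp add: A_def)
    ultimately have "g \<otimes> s \<otimes> s \<in> generate W A" by (rule generate.eng)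
    then show ?thesis using g sc sS by (simp add: m_assoc S_sq)
  next
    case False
    then show ?thesis using that sc by (intro pos) (simp_all add: centralizer_conjugate)
  qed
  moreover have "generate W A \<subseteq> centralizer W s"
    using A centralizer_subgroup by (rule generate_subgroup_incl)
  ultimately have "generate W A = centralizer W s" by blast
  then have "generate (W\<lparr>carrier := centralizer W s\<rparr>) A = centralizer W s"
    using generate_consistent[OF A centralizer_subgroup] by simp
  then show ?thesis using fin A by (auto simp: finitely_generated_def)
qed

end

end

theorem corollary8:
  fixes W :: "('a, 'b) monoid_scheme" and S :: "'a set" and s :: 'a
  assumes "coxeter_system W S" and "s \<in> S"
  defines "V \<equiv> component S (oddly_joined W) s"
  shows "(\<forall>Z \<delta>.
            Z \<subseteq> edge_loops V (oddly_joined W) s \<and>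
            generate (fundamental_group S (oddly_joined W) s)
              (loop_class S (oddly_joined W) s ` Z)
              = carrier (fundamental_group S (oddly_joined W) s) \<and>
            (\<forall>t \<in> V. edge_path V (oddly_joined W) s t (\<delta> t)) \<longrightarrow>
            generate W (path_element W ` Z) = Gamma_Omega W S s \<and>
            generate W (path_element W ` Z \<union>
                {path_reflection W (\<delta> t) u | t u. t \<in> V \<and> u \<in> S \<and> evenly_joined W t u})
              = W_Gamma_Omega W S s)
         \<and> (finite S \<longrightarrow> finitely_generated (W\<lparr>carrier := centralizer W s\<rparr>))"
proof -
  interpret coxeter W S
    using assms(1) by (auto simp: coxeter_def coxeter_axioms_def coxeter_system_def)
  have "generate W (path_element W ` Z) = Gamma_Omega W S s \<and>
      generate W (path_element W ` Z \<union>
          {path_reflection W (\<delta> t) u | t u. t \<in> V \<and> u \<in> S \<and> evenly_joined W t u})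
        = W_Gamma_Omega W S s"
    if Z: "Z \<subseteq> edge_loops V (oddly_joined W) s"
      and gen: "generate (fundamental_group S (oddly_joined W) s)
        (loop_class S (oddly_joined W) s ` Z) = carrier (fundamental_group S (oddly_joined W) s)"
      and \<delta>: "\<forall>t \<in> V. edge_path V (oddly_joined W) s t (\<delta> t)" for Z \<delta>
  proof -
    \<comment> \<open>Loops and paths inside the component are also loops and paths of the graph on
      \<open>S\<close>, for which the preceding lemmas are stated.\<close>
    have ZS: "Z \<subseteq> edge_loops S (oddly_joined W) s"
      using Z edge_path_component[OF assms(2)] by (auto simp: edge_loops_def V_def)
    have Gamma: "generate W (path_element W ` Z) = Gamma_Omega W S s"
      using assms(2) ZS gen by (rule Gamma_Omega_generators)
    moreover have "edge_path S (oddly_joined W) s t (\<delta> t)"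
      if "t \<in> component S (oddly_joined W) s" for t
      using \<delta> that edge_path_component[OF assms(2)] unfolding V_def by blast
    ultimately show ?thesis
      unfolding V_def using W_Gamma_Omega_generators[OF assms(2) _ ZS Gamma] by blast
  qed
  then show ?thesis using finitely_generated_centralizer[OF assms(2)] by blast
qed

end
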